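(* Let $X$ be an infinite dimensional complex Banach space and let $T\in L(X)$. The following conditions are equivalent: (i) $K(T)$ is closed and there exists a closed subspace $N$ of $X$ such that $N\subset H_0(T)$ and $(K(T),N)\in Red(T)$; (ii) there exists $(M,N)\in Red(T)$ such that $T_M$ is surjective and $T_N$ is quasinilpotent; (iii) $T$ admits a generalized Kato decomposition and $0$ is not an accumulation point of $\sigma_{su}(T)$; (iv) $T$ admits a generalized Kato decomposition and $0$ is not an interior point of $\sigma_{su}(T)$; (v) there exists a bounded projection $P$ on $X$ which commutes with $T$ such that $T+P$ is surjective and $TP$ is quasinilpotent; (vi) there exists $(M,N)\in Red(T)$ such that $T_M$ is lower semi-Browder and $T_N$ is quasinilpotent; (vii) $T$ admits a generalized Kato decomposition and $0$ is not an accumulation point of $\sigma_{\mathcal{B}_-}(T)$; (viii) $T$ admits a generalized Kato decomposition and $0$ is not an interior point of $\sigma_{\mathcal{B}_-}(T)$; (ix) there exists a bounded projection $P$ on $X$ which commutes with $T$ such that $T+P$ is lower semi-Browder and $TP$ is quasinilpotent. In particular, if $T$ satisfies any of the conditions (i)–(ix), then the subspace $M$ in (ii) is uniquely determined and $M=K(T)$.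
   Context: $L(Y)$ is the algebra of bounded linear operators on a Banach space $Y$ (finite dimensional or zero spaces allowed for $Y$); $T-\lambda$ means $T-\lambda I$; $N(S)$, $R(S)$ denote kernel and range of $S\in L(Y)$. $S$ is lower semi-Fredholm if $\operatorname{codim}R(S)<\infty$; the descent is $\operatorname{dsc}(S)=\inf\{n\ge0:R(S^n)=R(S^{n+1})\}$ ($\inf\emptyset=\infty$); $S$ is lower semi-Browder if it is lower semi-Fredholm and $\operatorname{dsc}(S)<\infty$. $\sigma_{su}(T)=\{\lambda\in\mathbb{C}:T-\lambda\text{ is not surjective}\}$, $\sigma_{\mathcal{B}_-}(T)=\{\lambda\in\mathbb{C}:T-\lambda\text{ is not lower semi-Browder}\}$. $S$ is quasinilpotent if $\|S^n\|^{1/n}\to 0$. The quasinilpotent part of $T$ is $H_0(T)=\{x\in X:\lim_{n\to\infty}\|T^nx\|^{1/n}=0\}$. The analytical core $K(T)$ is the set of all $x\in X$ for which there exist $c>0$ and a sequence $(x_n)_{n\ge1}$ in $X$ with $Tx_1=x$, $Tx_{n+1}=x_n$ and $\|x_n\|\le c^n\|x\|$ for all $n\in\mathbb{N}$. $(M,N)\in Red(T)$ means that $M,N$ are closed $T$-invariant subspaces of $X$ with $X=M\oplus N$; $T_M\in L(M)$, $T_N\in L(N)$ are the restrictions of $T$. $S\in L(Y)$ is Kato if $R(S)$ is closed and $N(S)\subset R(S^n)$ for all $n\ge 0$. $T$ admits a generalized Kato decomposition if there is $(M,N)\in Red(T)$ such that $T_M$ is Kato and $T_N$ is quasinilpotent.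 *)

theory Defs
  imports "HOL-Analysis.Analysis" "HOL-Library.Extended_Nat"
begin

text \<open>A complex normed space is a real normed space carrying a compatible complex scalar
  multiplication.\<close>

class complex_normed_vector = real_normed_vector +
  fixes scaleC :: "complex \<Rightarrow> 'a \<Rightarrow> 'a"  (infixr \<open>*\<^sub>C\<close> 75)
  assumes scaleC_add_right: "a *\<^sub>C (x + y) = a *\<^sub>C x + a *\<^sub>C y"
    and scaleC_add_left: "(a + b) *\<^sub>C x = a *\<^sub>C x + b *\<^sub>C x"
    and scaleC_scaleC: "a *\<^sub>C b *\<^sub>C x = (a * b) *\<^sub>C x"
    and scaleR_scaleC: "r *\<^sub>R x = complex_of_real r *\<^sub>C x"
    and norm_scaleC: "norm (a *\<^sub>C x) = cmod a * norm x"

class complex_banach = complex_normed_vector + banach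

instantiation complex :: complex_banach
begin

definition scaleC_complex :: "complex \<Rightarrow> complex \<Rightarrow> complex"
  where "scaleC_complex a x = a * x"

instance
  by standard (simp_all add: scaleC_complex_def algebra_simps norm_mult scaleR_conv_of_real)

end

lemma scaleC_one: "1 *\<^sub>C x = (x :: 'a :: complex_normed_vector)"
  using scaleR_scaleC[of 1 x] by simp

global_interpretation complex_vector:
  vector_space "scaleC :: complex \<Rightarrow> 'a \<Rightarrow> 'a :: complex_normed_vector"
  by standard (simp_all add: scaleC_add_right scaleC_add_left scaleC_scaleC scaleC_one)

definition infinite_dimensional :: "'a :: complex_normed_vector itself \<Rightarrow> bool"
  where "infinite_dimensional _ \<longleftrightarrow> \<not> (\<exists>B :: 'a set. finite B \<and> complex_vector.span B = UNIV)"

definition bounded_clinear :: "('a :: complex_normed_vector \<Rightarrow> 'b :: complex_normed_vector) \<Rightarrow> bool"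
  where "bounded_clinear f \<longleftrightarrow> bounded_linear f \<and> (\<forall>c x. f (c *\<^sub>C x) = c *\<^sub>C f x)"

text \<open>The notions for an operator on a Banach space \<open>Y\<close> are relativised to a closed subspace
  \<open>Y\<close> of the ambient space that is invariant under \<open>S\<close>; they depend only on the values of \<open>S\<close>
  on \<open>Y\<close>, so that \<open>S\<close> stands for its restriction to \<open>Y\<close>. The case \<open>Y = UNIV\<close> is that of an
  operator on the whole space.\<close>

definition closed_csubspace :: "'a :: complex_normed_vector set \<Rightarrow> bool"
  where "closed_csubspace M \<longleftrightarrow> complex_vector.subspace M \<and> closed M"

text \<open>\<open>codim_in Y R\<close> is the dimension of \<open>Y / R\<close>: the least number of vectors of \<open>Y\<close> whose
  cosets span the quotient.\<close>

definition codim_in :: "'a :: complex_normed_vector set \<Rightarrow> 'a set \<Rightarrow> enat"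
  where "codim_in Y R =
    (INF B \<in> {B. finite B \<and> B \<subseteq> Y \<and> complex_vector.span (R \<union> B) = Y}. enat (card B))"

definition lower_semi_Fredholm_on :: "'a :: complex_normed_vector set \<Rightarrow> ('a \<Rightarrow> 'a) \<Rightarrow> bool"
  where "lower_semi_Fredholm_on Y S \<longleftrightarrow> codim_in Y (S ` Y) < \<infinity>"

text \<open>The infimum of the empty set in \<^typ>\<open>enat\<close> is \<open>\<infinity>\<close>.\<close>

definition descent_on :: "'a set \<Rightarrow> ('a \<Rightarrow> 'a) \<Rightarrow> enat"
  where "descent_on Y S = (INF n \<in> {n. (S ^^ n) ` Y = (S ^^ (n + 1)) ` Y}. enat n)"

definition lower_semi_Browder_on :: "'a :: complex_normed_vector set \<Rightarrow> ('a \<Rightarrow> 'a) \<Rightarrow> bool"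
  where "lower_semi_Browder_on Y S \<longleftrightarrow> lower_semi_Fredholm_on Y S \<and> descent_on Y S < \<infinity>"

text \<open>As for \<^const>\<open>onorm\<close>, \<open>x = 0\<close> contributes the value \<open>0\<close>, so the zero space needs no
  special treatment.\<close>

definition onorm_on :: "'a :: real_normed_vector set \<Rightarrow> ('a \<Rightarrow> 'a) \<Rightarrow> real"
  where "onorm_on Y S = (SUP x\<in>Y. norm (S x) / norm x)"

lemma onorm_on_UNIV: "onorm_on UNIV S = onorm S"
  by (simp add: onorm_on_def onorm_def)

definition quasinilpotent_on :: "'a :: real_normed_vector set \<Rightarrow> ('a \<Rightarrow> 'a) \<Rightarrow> bool"
  where "quasinilpotent_on Y S \<longleftrightarrow> (\<lambda>n. root n (onorm_on Y (S ^^ n))) \<longlonglongrightarrow> 0"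

definition Kato_on :: "'a :: real_normed_vector set \<Rightarrow> ('a \<Rightarrow> 'a) \<Rightarrow> bool"
  where "Kato_on Y S \<longleftrightarrow> closed (S ` Y) \<and> (\<forall>n. {x \<in> Y. S x = 0} \<subseteq> (S ^^ n) ` Y)"

definition Red :: "('a :: complex_normed_vector \<Rightarrow> 'a) \<Rightarrow> ('a set \<times> 'a set) set"
  where "Red T = {(M, N). closed_csubspace M \<and> closed_csubspace N \<and> T ` M \<subseteq> M \<and> T ` N \<subseteq> N \<and>
    M \<inter> N = {0} \<and> {x + y | x y. x \<in> M \<and> y \<in> N} = UNIV}"

definition generalized_Kato_decomposition :: "('a :: complex_normed_vector \<Rightarrow> 'a) \<Rightarrow> bool"
  where "generalized_Kato_decomposition T \<longleftrightarrow>
    (\<exists>(M, N) \<in> Red T. Kato_on M T \<and> quasinilpotent_on N T)"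

definition quasinilpotent_part :: "('a :: real_normed_vector \<Rightarrow> 'a) \<Rightarrow> 'a set"
  where "quasinilpotent_part T = {x. (\<lambda>n. root n (norm ((T ^^ n) x))) \<longlonglongrightarrow> 0}"

definition analytical_core :: "('a :: real_normed_vector \<Rightarrow> 'a) \<Rightarrow> 'a set"
  where "analytical_core T = {x. \<exists>c > 0. \<exists>u :: nat \<Rightarrow> 'a. T (u 1) = x \<and>
    (\<forall>n \<ge> 1. T (u (n + 1)) = u n \<and> norm (u n) \<le> c ^ n * norm x)}"

definition surjective_spectrum :: "('a :: complex_normed_vector \<Rightarrow> 'a) \<Rightarrow> complex set"
  where "surjective_spectrum T = {l. \<not> surj (\<lambda>x. T x - l *\<^sub>C x)}"

definition lower_semi_Browder_spectrum :: "('a :: complex_normed_vector \<Rightarrow> 'a) \<Rightarrow> complex set"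
  where "lower_semi_Browder_spectrum T =
    {l. \<not> lower_semi_Browder_on UNIV (\<lambda>x. T x - l *\<^sub>C x)}"

definition bounded_projection :: "('a :: complex_normed_vector \<Rightarrow> 'a) \<Rightarrow> bool"
  where "bounded_projection P \<longleftrightarrow> bounded_clinear P \<and> P \<circ> P = P"

end

theory Submission
  imports Defs
begin

text \<open>All conditions are equivalent to (ii). By the open mapping theorem a surjective \<open>T\<^sub>M\<close> stays
  surjective under small perturbations, while \<open>T\<^sub>N - c\<close> is invertible for every \<open>c \<noteq> 0\<close>; this gives
  (iii). Conversely, a Kato operator is bounded below modulo the intersection of the ranges of its
  powers, so it is surjective as soon as \<open>T - c\<close> is surjective for arbitrarily small \<open>c\<close>.
  A lower semi-Browder operator is the direct sum of a surjective operator on the stable range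
  \<open>R = R(T\<^sup>p)\<close> and a nilpotent operator on a finite dimensional invariant complement of \<open>R\<close>, which
  exists because \<open>T R = R\<close>. Hence every \<open>T - c\<close> that is lower semi-Browder is a limit of surjective
  ones, and (vi), (viii), (ix) reduce to (ii) and (iv).\<close>

subsection \<open>Banach space operators on closed subspaces\<close>

lemma absorbing_closure_contains_ball:
  fixes A W :: "'a :: banach set"
  assumes W: "subspace W" "closed W" and A: "A \<subseteq> W" "convex A" "\<And>x. x \<in> A \<Longrightarrow> - x \<in> A"
    and absorb: "\<And>x. x \<in> W \<Longrightarrow> \<exists>n. x \<in> (*\<^sub>R) (real (Suc n)) ` A"
  obtains r where "r > 0" "ball 0 r \<inter> W \<subseteq> closure A"
proof -
  define F where "F n = (*\<^sub>R) (real (Suc n)) ` closure A" for n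
  have cA: "closure A \<subseteq> W"
    using A(1) W(2) by (simp add: closure_minimal)
  have clF: "closed (F n)" for n
    unfolding F_def by (intro closed_scaling closed_closure)
  have FW: "F n \<subseteq> W" for n
    using cA W(1) by (auto simp: F_def intro: subspace_scale simp del: of_nat_Suc)
  have UF: "\<Union>(range F) = W"
  proof (intro equalityI subsetI)
    fix x assume "x \<in> W"
    then obtain n where "x \<in> (*\<^sub>R) (real (Suc n)) ` A"
      using absorb by blast
    also have "\<dots> \<subseteq> F n"
      unfolding F_def by (intro image_mono closure_subset)
    finally show "x \<in> \<Union>(range F)"
      by blast
  qed (use FW in blast)
  have "\<exists>n. top_of_set W interior_of F n \<noteq> {}"
  proof (rule ccontr)
    assume empty: "\<not> ?thesis"
    have "closedin (top_of_set W) (F n)" for n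
      using FW clF by (rule closed_subset)
    then have "top_of_set W interior_of \<Union>(range F) = {}"
      using empty W(2)
      by (intro Baire_category_alt disjI1 completely_metrizable_space_closedin
            completely_metrizable_space_euclidean) auto
    then show False
      unfolding UF using W(1) by (metis interior_of_topspace topspace_euclidean_subtopology empty_iff subspace_0)
  qed
  then obtain n y where "y \<in> top_of_set W interior_of F n"
    by blast
  then obtain U where U: "openin (top_of_set W) U" "y \<in> U" "U \<subseteq> F n"
    by (auto simp: interior_of_def)
  then obtain e where e: "e > 0" "ball y e \<inter> W \<subseteq> U" and yW: "y \<in> W"
    unfolding openin_contains_ball by (meson subsetD)
  have sym: "- x \<in> closure A" if "x \<in> closure A" for x
  proof -
    have "uminus ` closure A \<subseteq> closure A"
      using A(3) closure_subset[of A]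
      by (intro image_closure_subset continuous_intros) auto
    then show ?thesis
      using that by blast
  qed
  have "ball 0 (e / real (Suc n)) \<inter> W \<subseteq> closure A"
  proof
    fix w assume w: "w \<in> ball 0 (e / real (Suc n)) \<inter> W"
    have mem: "(1 / real (Suc n)) *\<^sub>R y + v \<in> closure A" if "v = w \<or> v = - w" for v
    proof -
      have "norm (real (Suc n) *\<^sub>R v) < e"
        using w that by (auto simp: field_simps simp del: of_nat_Suc)
      moreover have "v \<in> W"
        using w that W(1) by (auto intro: subspace_neg)
      ultimately have "y + real (Suc n) *\<^sub>R v \<in> ball y e \<inter> W"
        using W(1) yW by (auto simp: dist_norm intro: subspace_add subspace_scale simp del: of_nat_Suc)
      then have "y + real (Suc n) *\<^sub>R v \<in> F n"
        using e(2) U(3) by blast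
      then obtain a where a: "a \<in> closure A" "y + real (Suc n) *\<^sub>R v = real (Suc n) *\<^sub>R a"
        by (auto simp: F_def)
      have "(1 / real (Suc n)) *\<^sub>R y + v = (1 / real (Suc n)) *\<^sub>R (y + real (Suc n) *\<^sub>R v)"
        by (simp add: scaleR_add_right del: of_nat_Suc)
      also have "\<dots> = a"
        by (simp add: a(2) del: of_nat_Suc)
      finally show ?thesis
        using a(1) by simp
    qed
    let ?z = "(1 / real (Suc n)) *\<^sub>R y"
    have "w = (1/2) *\<^sub>R (?z + w) + (1/2) *\<^sub>R (- (?z + - w))"
      by (simp add: algebra_simps flip: scaleR_add_left del: of_nat_Suc)
    moreover have "(1/2) *\<^sub>R (?z + w) + (1/2) *\<^sub>R (- (?z + - w)) \<in> closure A"
      by (rule convexD[OF convex_closure[OF A(2)] mem sym[OF mem]]) auto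
    ultimately show "w \<in> closure A"
      by metis
  qed
  with e(1) show thesis
    by (intro that[of "e / real (Suc n)"]) auto
qed

text \<open>Successive approximation: correcting the error of the approximate solutions yields a series
  dominated by a geometric one.\<close>

lemma approximate_solutions_imp_solution:
  fixes f :: "'a :: banach \<Rightarrow> 'b :: real_normed_vector"
  assumes f: "bounded_linear f" and V: "subspace V" "closed V" and W: "subspace W" "f ` V \<subseteq> W"
    and approx: "\<And>y. y \<in> W \<Longrightarrow> \<exists>x\<in>V. norm x \<le> C * norm y \<and> norm (y - f x) \<le> norm y / 2"
    and y: "y \<in> W"
  shows "\<exists>x\<in>V. f x = y \<and> norm x \<le> 2 * C * norm y"
proof -
  interpret f: bounded_linear f
    by fact
  obtain g where g: "\<And>y. y \<in> W \<Longrightarrow> g y \<in> V \<and> norm (g y) \<le> C * norm y \<and> norm (y - f (g y)) \<le> norm y / 2"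
    using approx by metis
  define r where "r n = ((\<lambda>y. y - f (g y)) ^^ n) y" for n
  have r0: "r 0 = y" and rS: "r (Suc n) = r n - f (g (r n))" for n
    by (simp_all add: r_def)
  have rW: "r n \<in> W" for n
  proof (induction n)
    case (Suc n)
    then show ?case
      using g W by (auto simp: rS intro!: subspace_diff)
  qed (simp add: r0 y)
  have rn: "norm (r n) \<le> norm y * (1/2) ^ n" for n
  proof (induction n)
    case (Suc n)
    then show ?case
      using g[OF rW[of n]] by (auto simp: rS)
  qed (simp add: r0)
  have C: "C \<ge> 0 \<or> y = 0"
  proof -
    have "0 \<le> C * norm y"
      using g[OF y] norm_ge_zero order_trans by blast
    then show ?thesis
      by (metis norm_eq_zero norm_ge_zero zero_le_mult_iff order_antisym)
  qed
  have gn: "norm (g (r n)) \<le> C * norm y * (1/2) ^ n" for n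
  proof -
    have "norm (g (r n)) \<le> C * norm (r n)"
      using g rW by blast
    also have "\<dots> \<le> C * (norm y * (1/2) ^ n)"
      using C rn[of n] by (auto intro: mult_left_mono)
    finally show ?thesis
      by (simp add: mult.assoc)
  qed
  have geo: "(\<lambda>n. C * norm y * (1/2) ^ n) sums (C * norm y * 2)"
    using geometric_sums[of "1/2::real"] by (intro sums_mult) auto
  have sn: "summable (\<lambda>n. norm (g (r n)))"
    using gn by (intro summable_comparison_test[OF _ sums_summable[OF geo]]) auto
  then have s: "summable (\<lambda>n. g (r n))"
    by (rule summable_norm_cancel)
  define x where "x = (\<Sum>n. g (r n))"
  have lim: "(\<lambda>n. \<Sum>i<n. g (r i)) \<longlonglongrightarrow> x"
    using s unfolding x_def by (simp add: summable_LIMSEQ)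
  have "x \<in> V"
    using g rW V by (intro closed_sequentially[OF V(2) _ lim]) (auto intro: subspace_sum)
  moreover have "f x = y"
  proof -
    have part: "f (\<Sum>i<n. g (r i)) = y - r n" for n
      by (induction n) (simp_all add: f.zero f.add r0 rS)
    have "r \<longlonglongrightarrow> 0"
    proof (rule Lim_null_comparison)
      show "(\<lambda>n. norm y * (1/2) ^ n) \<longlonglongrightarrow> 0"
        by (intro tendsto_mult_right_zero LIMSEQ_power_zero) simp
    qed (simp add: rn)
    then have "(\<lambda>n. y - r n) \<longlonglongrightarrow> y - 0"
      by (intro tendsto_intros)
    moreover have "(\<lambda>n. y - r n) \<longlonglongrightarrow> f x"
      using f.tendsto[OF lim] by (simp add: part)
    ultimately show ?thesis
      using LIMSEQ_unique by fastforce
  qed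
  moreover have "norm x \<le> 2 * C * norm y"
  proof -
    have "norm x \<le> (\<Sum>n. norm (g (r n)))"
      unfolding x_def using sn by (rule summable_norm)
    also have "\<dots> \<le> (\<Sum>n. C * norm y * (1/2) ^ n)"
      using gn sn sums_summable[OF geo] by (intro suminf_le) auto
    also have "\<dots> = 2 * C * norm y"
      using sums_unique[OF geo] by simp
    finally show ?thesis .
  qed
  ultimately show ?thesis
    by blast
qed

lemma open_mapping_on:
  fixes f :: "'a :: banach \<Rightarrow> 'b :: banach"
  assumes f: "bounded_linear f" and V: "subspace V" "closed V" and cl: "closed (f ` V)"
  obtains C where "C > 0" "\<And>y. y \<in> f ` V \<Longrightarrow> \<exists>x\<in>V. f x = y \<and> norm x \<le> C * norm y"
proof -
  interpret f: bounded_linear f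
    by fact
  let ?W = "f ` V" and ?A = "f ` (V \<inter> cball 0 1)"
  have W: "subspace ?W"
    by (rule real_vector.linear_subspace_image[OF _ V(1), unfolded linear_def[symmetric]]) (rule f.linear)
  obtain r where r: "r > 0" "ball 0 r \<inter> ?W \<subseteq> closure ?A"
  proof (rule absorbing_closure_contains_ball[OF W cl, of ?A])
    show "convex ?A"
      using V(1) by (intro convex_linear_image f.linear convex_Int subspace_imp_convex convex_cball)
    show "- x \<in> ?A" if x: "x \<in> ?A" for x
    proof -
      obtain v where "v \<in> V" "norm v \<le> 1" "x = f v"
        using x by auto
      then have "- v \<in> V \<inter> cball 0 1" "- x = f (- v)"
        using V(1) by (auto simp: f.neg subspace_neg)
      then show ?thesis
        by blast
    qed
    show "\<exists>n. x \<in> (*\<^sub>R) (real (Suc n)) ` ?A" if x: "x \<in> ?W" for x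
    proof -
      obtain v where v: "v \<in> V" "x = f v"
        using x by auto
      obtain n where n: "norm v \<le> real n"
        using real_arch_simple by blast
      have "(1 / real (Suc n)) *\<^sub>R v \<in> V \<inter> cball 0 1"
        using n v V(1) by (auto simp: field_simps intro: subspace_scale)
      moreover have "x = real (Suc n) *\<^sub>R f ((1 / real (Suc n)) *\<^sub>R v)"
        using v by (simp add: f.scaleR del: of_nat_Suc)
      ultimately show ?thesis
        by blast
    qed
  qed auto
  have "\<exists>x\<in>V. norm x \<le> 2 / r * norm y \<and> norm (y - f x) \<le> norm y / 2" if y: "y \<in> ?W" for y
  proof (cases "y = 0")
    case True
    then show ?thesis
      using V(1) by (auto intro!: bexI[of _ 0] simp: f.zero subspace_0)
  next
    case False
    define t where "t = 2 * norm y / r"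
    have t: "t > 0"
      using False r(1) by (simp add: t_def)
    have "(1 / t) *\<^sub>R y \<in> ball 0 r \<inter> ?W"
      using W y False r(1) t by (auto simp: t_def intro: subspace_scale)
    then have "(1 / t) *\<^sub>R y \<in> closure ?A"
      using r(2) by blast
    then obtain x where x: "x \<in> V" "norm x \<le> 1" "norm (f x - (1 / t) *\<^sub>R y) < r / 4"
      using r(1) by (auto simp: closure_approachable dist_norm elim!: allE[of _ "r / 4"])
    have "y - f (t *\<^sub>R x) = - t *\<^sub>R (f x - (1 / t) *\<^sub>R y)"
      using t by (simp add: f.scaleR algebra_simps)
    then have "norm (y - f (t *\<^sub>R x)) = t * norm (f x - (1 / t) *\<^sub>R y)"
      using t by simp
    also have "\<dots> \<le> t * (r / 4)"
      using x(3) t by (intro mult_left_mono) auto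
    finally have "norm (y - f (t *\<^sub>R x)) \<le> norm y / 2"
      using r(1) by (simp add: t_def)
    moreover have "norm (t *\<^sub>R x) \<le> t"
      using x(2) t by (simp add: mult_left_le)
    then have "norm (t *\<^sub>R x) \<le> 2 / r * norm y"
      by (simp add: t_def)
    ultimately show ?thesis
      using x(1) V(1) subspace_scale by blast
  qed
  then have "\<exists>x\<in>V. f x = y \<and> norm x \<le> 2 * (2 / r) * norm y" if "y \<in> ?W" for y
    using that by (intro approximate_solutions_imp_solution[OF f V W order_refl]) auto
  with r(1) show thesis
    by (intro that[of "2 * (2 / r)"]) auto
qed

lemma uniform_boundedness_on:
  fixes A :: "nat \<Rightarrow> 'a :: banach \<Rightarrow> 'b :: real_normed_vector"
  assumes A: "\<And>n. bounded_linear (A n)" and N: "subspace N" "closed N"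
    and bdd: "\<And>x. x \<in> N \<Longrightarrow> \<exists>B. \<forall>n. norm (A n x) \<le> B"
  obtains C where "C > 0" "\<And>n x. x \<in> N \<Longrightarrow> norm (A n x) \<le> C * norm x"
proof -
  let ?S = "{x \<in> N. \<forall>n. norm (A n x) \<le> 1}"
  have S: "?S = N \<inter> (\<Inter>n. A n -` cball 0 1)"
    by auto
  have clS: "closed ?S"
    unfolding S using A N(2)
    by (intro closed_Int closed_INT ballI closed_vimage) (auto simp: linear_continuous_on)
  obtain r where r: "r > 0" "ball 0 r \<inter> N \<subseteq> closure ?S"
  proof (rule absorbing_closure_contains_ball[OF N, of ?S])
    show "convex ?S"
      unfolding S using A N(1)
      by (intro convex_Int convex_INT convex_linear_vimage convex_cball subspace_imp_convex)
        (auto intro: bounded_linear.linear)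
    show "- x \<in> ?S" if "x \<in> ?S" for x
      using that N(1) A by (auto simp: bounded_linear.linear linear_neg subspace_neg)
    show "\<exists>n. x \<in> (*\<^sub>R) (real (Suc n)) ` ?S" if x: "x \<in> N" for x
    proof -
      obtain B where B: "\<And>n. norm (A n x) \<le> B"
        using bdd[OF x] by auto
      obtain k where k: "B \<le> real k"
        using real_arch_simple by blast
      have "norm (A n x) \<le> 1 + real k" for n
        using B[of n] k by linarith
      then have "(1 / real (Suc k)) *\<^sub>R x \<in> ?S"
        using x N(1) A by (auto simp: bounded_linear.linear linear_scale field_simps intro: subspace_scale)
      moreover have "x = real (Suc k) *\<^sub>R (1 / real (Suc k)) *\<^sub>R x"
        by (simp del: of_nat_Suc)
      ultimately show ?thesis
        by blast
    qed
  qed auto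
  have "norm (A n x) \<le> 2 / r * norm x" if x: "x \<in> N" for n x
  proof (cases "x = 0")
    case True
    then show ?thesis
      using A by (simp add: bounded_linear.linear linear_0)
  next
    case False
    define t where "t = r / (2 * norm x)"
    have t: "t > 0"
      using r(1) False by (simp add: t_def)
    have "t *\<^sub>R x \<in> ball 0 r \<inter> N"
      using x N(1) r(1) False by (auto simp: t_def intro: subspace_scale)
    then have "t *\<^sub>R x \<in> ?S"
      using r(2) unfolding closure_closed[OF clS] by (rule subsetD[rotated])
    then have "norm (A n (t *\<^sub>R x)) \<le> 1"
      by simp
    then have "t * norm (A n x) \<le> 1"
      using A t by (simp add: bounded_linear.linear linear_scale)
    then show ?thesis
      using r(1) False by (simp add: t_def field_simps)
  qed
  with r(1) show thesis
    by (intro that[of "2 / r"]) auto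
qed

subsection \<open>Quasinilpotence and reducing pairs\<close>

lemma csubspace_imp_subspace: "complex_vector.subspace M \<Longrightarrow> subspace M"
  by (simp add: complex_vector.subspace_def real_vector.subspace_def scaleR_scaleC)

lemma closed_csubspaceD:
  assumes "closed_csubspace M"
  shows "closed M" "complex_vector.subspace M" "subspace M"
  using assms by (auto simp: closed_csubspace_def csubspace_imp_subspace)

lemma bounded_clinearD:
  assumes "bounded_clinear T"
  shows "bounded_linear T" "T (x + y) = T x + T y" "T (x - y) = T x - T y" "T (- x) = - T x"
    "T 0 = 0" "T (c *\<^sub>C x) = c *\<^sub>C T x"
proof -
  show bl: "bounded_linear T" and "T (c *\<^sub>C x) = c *\<^sub>C T x"
    using assms by (auto simp: bounded_clinear_def)
  then interpret bounded_linear T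
    by simp
  show "T (x + y) = T x + T y" "T (x - y) = T x - T y" "T (- x) = - T x" "T 0 = 0"
    by (simp_all add: add diff neg zero)
qed

lemma bounded_clinear_compose:
  assumes "bounded_clinear S" "bounded_clinear T"
  shows "bounded_clinear (\<lambda>x. S (T x))"
  using assms by (auto simp: bounded_clinear_def intro: bounded_linear_compose)

lemma bounded_clinear_add:
  assumes "bounded_clinear S" "bounded_clinear T"
  shows "bounded_clinear (\<lambda>x. S x + T x)"
  using assms by (auto simp: bounded_clinear_def scaleC_add_right intro: bounded_linear_add)

lemma bounded_clinear_ident: "bounded_clinear (\<lambda>x. x)"
  by (simp add: bounded_clinear_def bounded_linear_ident)

lemma bounded_clinear_scaleC: "bounded_clinear (\<lambda>x. c *\<^sub>C x)"
proof -
  have "bounded_linear (\<lambda>x. c *\<^sub>C x)"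
    by (rule bounded_linear_intro[where K = "cmod c"])
      (simp_all add: scaleC_add_right norm_scaleC scaleR_scaleC scaleC_scaleC mult.commute)
  then show ?thesis
    by (simp add: bounded_clinear_def scaleC_scaleC mult.commute)
qed

lemma bounded_clinear_funpow:
  fixes T :: "'a :: complex_normed_vector \<Rightarrow> 'a"
  assumes "bounded_clinear T"
  shows "bounded_clinear (T ^^ n)"
proof (induction n)
  case 0
  then show ?case
    by (simp add: id_def bounded_clinear_ident)
next
  case (Suc n)
  then show ?case
    using bounded_clinear_compose[OF assms Suc] by (simp add: comp_def)
qed

lemma bounded_linear_funpow:
  fixes T :: "'a :: real_normed_vector \<Rightarrow> 'a"
  assumes "bounded_linear T"
  shows "bounded_linear (T ^^ n)"
proof (induction n)
  case 0
  then show ?case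
    by (simp add: id_def bounded_linear_ident)
next
  case (Suc n)
  then show ?case
    using bounded_linear_compose[OF assms Suc] by (simp add: comp_def)
qed

lemma bounded_clinear_shift:
  assumes "bounded_clinear T"
  shows "bounded_clinear (\<lambda>x. T x - c *\<^sub>C x)"
  using bounded_clinear_add[OF assms bounded_clinear_scaleC[of "- c"]]
  by (simp add: complex_vector.scale_minus_left)

lemma funpow_image_subset: "T ` M \<subseteq> M \<Longrightarrow> (T ^^ n) ` M \<subseteq> M"
  by (induction n) auto

lemma funpow_image_Suc: "(T ^^ Suc n) ` M = T ` (T ^^ n) ` M" for T :: "'a \<Rightarrow> 'a"
  by (simp add: image_comp)

lemma funpow_image_eq: "T ` M = M \<Longrightarrow> (T ^^ n) ` M = M"
  by (induction n) (simp_all add: funpow_image_Suc del: funpow.simps(2))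

lemma csubspace_image:
  assumes "bounded_clinear T" "complex_vector.subspace M"
  shows "complex_vector.subspace (T ` M)"
  unfolding complex_vector.subspace_def
proof (intro conjI ballI allI)
  show "0 \<in> T ` M"
    using assms by (metis bounded_clinearD(5) complex_vector.subspace_0 image_eqI)
  show "x + y \<in> T ` M" if xy: "x \<in> T ` M" "y \<in> T ` M" for x y
  proof -
    obtain a b where "a \<in> M" "b \<in> M" "x = T a" "y = T b"
      using xy by auto
    then have "a + b \<in> M" "x + y = T (a + b)"
      using assms by (auto simp: bounded_clinearD intro: complex_vector.subspace_add)
    then show ?thesis
      by blast
  qed
  show "c *\<^sub>C x \<in> T ` M" if x: "x \<in> T ` M" for c x
  proof -
    obtain a where "a \<in> M" "x = T a"
      using x by auto
    then have "c *\<^sub>C a \<in> M" "c *\<^sub>C x = T (c *\<^sub>C a)"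
      using assms by (auto simp: bounded_clinearD intro: complex_vector.subspace_scale)
    then show ?thesis
      by blast
  qed
qed

lemma root_tendsto_zero_iff:
  fixes a :: "nat \<Rightarrow> real"
  assumes a: "\<And>n. 0 \<le> a n"
  shows "(\<lambda>n. root n (a n)) \<longlonglongrightarrow> 0 \<longleftrightarrow> (\<forall>e>0. \<exists>C>0. \<forall>n. a n \<le> C * e ^ n)"
proof (intro iffI allI impI)
  fix e :: real assume e: "e > 0" and lim: "(\<lambda>n. root n (a n)) \<longlonglongrightarrow> 0"
  have "\<forall>\<^sub>F n in sequentially. root n (a n) < e"
    using lim e by (rule order_tendstoD)
  then obtain m where m: "\<And>n. n \<ge> m \<Longrightarrow> root n (a n) < e"
    by (auto simp: eventually_sequentially)
  define C where "C = 1 + (\<Sum>i\<le>m. a i / e ^ i)"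
  have C: "C \<ge> 1"
    using a e by (auto simp: C_def intro!: sum_nonneg)
  have "a n \<le> C * e ^ n" for n
  proof (cases "n \<le> m")
    case True
    then have "a n / e ^ n \<le> (\<Sum>i\<le>m. a i / e ^ i)"
      using a e by (intro member_le_sum) auto
    then have "a n / e ^ n \<le> C"
      by (simp add: C_def)
    then show ?thesis
      using e by (simp add: field_simps)
  next
    case False
    then have "a n = root n (a n) ^ n"
      using a by (simp add: real_root_pow_pos2)
    also have "\<dots> \<le> e ^ n"
      using False m[of n] a by (intro power_mono) auto
    also have "\<dots> \<le> C * e ^ n"
      using C e by simp
    finally show ?thesis .
  qed
  with C show "\<exists>C>0. \<forall>n. a n \<le> C * e ^ n"
    by (intro exI[of _ C]) auto
next
  assume bound: "\<forall>e>0. \<exists>C>0. \<forall>n. a n \<le> C * e ^ n"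
  show "(\<lambda>n. root n (a n)) \<longlonglongrightarrow> 0"
  proof (rule order_tendstoI)
    fix e :: real assume "e < 0"
    then show "\<forall>\<^sub>F n in sequentially. e < root n (a n)"
      using a by (auto intro!: always_eventually less_le_trans[OF \<open>e < 0\<close>] simp: real_root_ge_zero)
  next
    fix e :: real assume e: "e > 0"
    then obtain C where C: "C > 0" "\<And>n. a n \<le> C * (e / 2) ^ n"
      using bound half_gt_zero by blast
    have "(\<lambda>n. C * (1/2) ^ n) \<longlonglongrightarrow> 0"
      by (intro tendsto_mult_right_zero LIMSEQ_power_zero) simp
    then have "\<forall>\<^sub>F n in sequentially. C * (1/2) ^ n < 1"
      by (rule order_tendstoD) simp
    with eventually_gt_at_top[of 0] show "\<forall>\<^sub>F n in sequentially. root n (a n) < e"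
    proof eventually_elim
      case (elim n)
      have "a n \<le> (C * (1/2) ^ n) * e ^ n"
        using C(2)[of n] by (simp add: power_divide)
      also have "\<dots> < 1 * e ^ n"
        using elim e by (intro mult_strict_right_mono) auto
      finally have "root n (a n) < root n (e ^ n)"
        using elim by simp
      then show ?case
        using elim e by (simp add: real_root_power_cancel)
    qed
  qed
qed

lemma quasinilpotent_part_iff:
  "x \<in> quasinilpotent_part T \<longleftrightarrow> (\<forall>e>0. \<exists>C>0. \<forall>n. norm ((T ^^ n) x) \<le> C * e ^ n)"
  by (simp add: quasinilpotent_part_def root_tendsto_zero_iff)

lemma
  assumes S: "bounded_linear S" and N: "subspace N"
  shows onorm_on: "x \<in> N \<Longrightarrow> norm (S x) \<le> onorm_on N S * norm x"
    and onorm_on_nonneg: "0 \<le> onorm_on N S"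
    and onorm_on_bound: "(\<And>x. x \<in> N \<Longrightarrow> norm (S x) \<le> C * norm x) \<Longrightarrow> 0 \<le> C \<Longrightarrow> onorm_on N S \<le> C"
proof -
  interpret bounded_linear S
    by fact
  have bdd: "bdd_above ((\<lambda>x. norm (S x) / norm x) ` N)"
    using S by (intro bdd_aboveI2[where M = "onorm S"]) (rule le_onorm)
  then have le: "norm (S x) / norm x \<le> onorm_on N S" if "x \<in> N" for x
    unfolding onorm_on_def using that by (intro cSUP_upper)
  show "norm (S x) \<le> onorm_on N S * norm x" if "x \<in> N"
    using le[OF that] by (cases "x = 0") (auto simp: zero field_simps)
  show "0 \<le> onorm_on N S"
    using le[of 0] N by (simp add: subspace_0 zero)
  show "onorm_on N S \<le> C" if "\<And>x. x \<in> N \<Longrightarrow> norm (S x) \<le> C * norm x" "0 \<le> C"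
    unfolding onorm_on_def
  proof (rule cSUP_least)
    show "N \<noteq> {}"
      using N subspace_0 by blast
    show "norm (S x) / norm x \<le> C" if "x \<in> N" for x
      using \<open>\<And>x. x \<in> N \<Longrightarrow> norm (S x) \<le> C * norm x\<close>[OF that] \<open>0 \<le> C\<close>
      by (cases "x = 0") (auto simp: field_simps)
  qed
qed

lemma quasinilpotent_on_iff:
  fixes T :: "'a :: banach \<Rightarrow> 'a"
  assumes T: "bounded_linear T" and N: "subspace N" "closed N"
  shows quasinilpotent_on_iff_uniform:
      "quasinilpotent_on N T \<longleftrightarrow> (\<forall>e>0. \<exists>C>0. \<forall>n. \<forall>x\<in>N. norm ((T ^^ n) x) \<le> C * e ^ n * norm x)"
        (is "_ \<longleftrightarrow> ?uniform")
    and quasinilpotent_on_iff_subset: "quasinilpotent_on N T \<longleftrightarrow> N \<subseteq> quasinilpotent_part T"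
proof -
  note Tn = bounded_linear_funpow[OF T]
  have 1: "?uniform" if qn: "quasinilpotent_on N T"
  proof (intro allI impI)
    fix e :: real assume "e > 0"
    then obtain C where C: "C > 0" "\<And>n. onorm_on N (T ^^ n) \<le> C * e ^ n"
      using qn unfolding quasinilpotent_on_def
      by (subst (asm) root_tendsto_zero_iff) (auto intro: onorm_on_nonneg Tn N)
    have "norm ((T ^^ n) x) \<le> C * e ^ n * norm x" if "x \<in> N" for n x
      using onorm_on[OF Tn N(1) that] mult_right_mono[OF C(2)] order_trans norm_ge_zero by blast
    with C(1) show "\<exists>C>0. \<forall>n. \<forall>x\<in>N. norm ((T ^^ n) x) \<le> C * e ^ n * norm x"
      by blast
  qed
  have 2: "N \<subseteq> quasinilpotent_part T" if u: ?uniform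
  proof
    fix x assume x: "x \<in> N"
    have "\<exists>C>0. \<forall>n. norm ((T ^^ n) x) \<le> C * e ^ n" if e: "e > 0" for e :: real
    proof -
      obtain C where C: "C > 0" "\<And>n x. x \<in> N \<Longrightarrow> norm ((T ^^ n) x) \<le> C * e ^ n * norm x"
        using u e by blast
      have "norm ((T ^^ n) x) \<le> C * (norm x + 1) * e ^ n" for n
      proof -
        have "norm ((T ^^ n) x) \<le> C * e ^ n * norm x"
          using C(2) x by blast
        also have "\<dots> \<le> C * e ^ n * (norm x + 1)"
          using C(1) e by (intro mult_left_mono) auto
        finally show ?thesis
          by (simp add: mult_ac)
      qed
      moreover have "C * (norm x + 1) > 0"
        using C(1) by (intro mult_pos_pos add_nonneg_pos) auto
      ultimately show ?thesis
        by blast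
    qed
    then show "x \<in> quasinilpotent_part T"
      by (simp add: quasinilpotent_part_iff)
  qed
  have 3: "quasinilpotent_on N T" if sub: "N \<subseteq> quasinilpotent_part T"
  proof -
    have "\<exists>C>0. \<forall>n. onorm_on N (T ^^ n) \<le> C * e ^ n" if e: "e > 0" for e :: real
    proof -
      define A where "A n x = (1 / e ^ n) *\<^sub>R (T ^^ n) x" for n x
      obtain C where C: "C > 0" "\<And>n x. x \<in> N \<Longrightarrow> norm (A n x) \<le> C * norm x"
      proof (rule uniform_boundedness_on[of A, OF _ N])
        show "bounded_linear (A n)" for n
          unfolding A_def by (intro bounded_linear_const_scaleR Tn)
        show "\<exists>B. \<forall>n. norm (A n x) \<le> B" if "x \<in> N" for x
        proof -
          have "x \<in> quasinilpotent_part T"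
            using sub \<open>x \<in> N\<close> by blast
          then obtain C where "\<And>n. norm ((T ^^ n) x) \<le> C * e ^ n"
            using e unfolding quasinilpotent_part_iff by blast
          then show ?thesis
            using e by (intro exI[of _ C]) (simp add: A_def field_simps)
        qed
      qed (rule that)
      have "onorm_on N (T ^^ n) \<le> C * e ^ n" for n
        using C(1) C(2)[of _ n] e by (intro onorm_on_bound Tn N) (auto simp: A_def field_simps)
      with C(1) show ?thesis
        by blast
    qed
    then show ?thesis
      unfolding quasinilpotent_on_def
      by (subst root_tendsto_zero_iff) (auto intro: onorm_on_nonneg Tn N)
  qed
  show "quasinilpotent_on N T \<longleftrightarrow> ?uniform" "quasinilpotent_on N T \<longleftrightarrow> N \<subseteq> quasinilpotent_part T"
    using 1 2 3 by blast+
qed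

lemma Red_iff:
  "(M, N) \<in> Red T \<longleftrightarrow> closed_csubspace M \<and> closed_csubspace N \<and> T ` M \<subseteq> M \<and> T ` N \<subseteq> N \<and>
    M \<inter> N \<subseteq> {0} \<and> (\<forall>x. \<exists>m\<in>M. \<exists>n\<in>N. x = m + n)"
proof -
  have "M \<inter> N = {0} \<longleftrightarrow> M \<inter> N \<subseteq> {0}" if "closed_csubspace M" "closed_csubspace N"
    using that[THEN closed_csubspaceD(2), THEN complex_vector.subspace_0] by blast
  moreover have "{x + y | x y. x \<in> M \<and> y \<in> N} = UNIV \<longleftrightarrow> (\<forall>x. \<exists>m\<in>M. \<exists>n\<in>N. x = m + n)"
    by blast
  ultimately show ?thesis
    by (simp add: Red_def cong: conj_cong)
qed

lemma RedD:
  assumes "(M, N) \<in> Red T"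
  shows "closed_csubspace M" "closed_csubspace N" "T ` M \<subseteq> M" "T ` N \<subseteq> N"
    "M \<inter> N \<subseteq> {0}" "\<exists>m\<in>M. \<exists>n\<in>N. x = m + n"
  using assms by (simp_all add: Red_iff)

text \<open>The complementary projection is bounded because the addition map \<open>M \<times> N \<rightarrow> X\<close> is open.\<close>

lemma Red_projection:
  fixes T :: "'a :: complex_banach \<Rightarrow> 'a"
  assumes T: "bounded_clinear T" and MN: "(M, N) \<in> Red T"
  obtains P where "bounded_projection P" "P \<circ> T = T \<circ> P" "\<And>x. P x \<in> N" "\<And>x. x - P x \<in> M"
    "\<And>x. x \<in> M \<Longrightarrow> P x = 0" "\<And>x. x \<in> N \<Longrightarrow> P x = x"
proof -
  note R = RedD[OF MN]
  note M = closed_csubspaceD[OF R(1)] and N = closed_csubspaceD[OF R(2)]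
  have "\<exists>y. y \<in> N \<and> x - y \<in> M" for x
    using R(6)[of x] by (metis add_diff_cancel_right')
  then obtain P where P: "\<And>x. P x \<in> N" "\<And>x. x - P x \<in> M"
    by metis
  have uniq: "P x = y" if "y \<in> N" "x - y \<in> M" for x y
  proof -
    have "P x - y \<in> N"
      using P that N(2) complex_vector.subspace_diff by blast
    moreover have "P x - y = (x - y) - (x - P x)"
      by simp
    then have "P x - y \<in> M"
      using P that M(2) complex_vector.subspace_diff by metis
    ultimately show ?thesis
      using R(5) by auto
  qed
  have add: "P (x + y) = P x + P y" for x y
  proof (rule uniq)
    have "x + y - (P x + P y) = (x - P x) + (y - P y)"
      by simp
    then show "x + y - (P x + P y) \<in> M"
      using P M(2) complex_vector.subspace_add by metis
  qed (use P N(2) complex_vector.subspace_add in blast)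
  have scale: "P (c *\<^sub>C x) = c *\<^sub>C P x" for c x
  proof (rule uniq)
    have "c *\<^sub>C x - c *\<^sub>C P x = c *\<^sub>C (x - P x)"
      by (simp add: complex_vector.scale_right_diff_distrib)
    then show "c *\<^sub>C x - c *\<^sub>C P x \<in> M"
      using P M(2) complex_vector.subspace_scale by metis
  qed (use P N(2) complex_vector.subspace_scale in blast)
  have comm: "P (T x) = T (P x)" for x
    using P R(3,4) by (intro uniq) (auto simp flip: bounded_clinearD(3)[OF T])
  have PN: "P x = x" if "x \<in> N" for x
    using that M(2) by (intro uniq) (auto simp: complex_vector.subspace_0)
  have PM: "P x = 0" if "x \<in> M" for x
    using that N(2) by (intro uniq) (auto simp: complex_vector.subspace_0)
  let ?f = "\<lambda>z :: 'a \<times> 'a. fst z + snd z"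
  have "x \<in> ?f ` (M \<times> N)" for x
    using P by (intro image_eqI[of _ _ "(x - P x, P x)"]) auto
  then have UNIV: "?f ` (M \<times> N) = UNIV"
    by blast
  obtain C where C: "\<And>x. x \<in> ?f ` (M \<times> N) \<Longrightarrow> \<exists>z\<in>M \<times> N. ?f z = x \<and> norm z \<le> C * norm x"
  proof (rule open_mapping_on[of ?f "M \<times> N"])
    show "bounded_linear ?f"
      by (intro bounded_linear_add bounded_linear_fst bounded_linear_snd)
    show "closed (?f ` (M \<times> N))"
      by (simp add: UNIV)
  qed (use M N in \<open>auto intro: closed_Times subspace_Times\<close>)
  have "norm (P x) \<le> norm x * C" for x
  proof -
    obtain m n where mn: "m \<in> M" "n \<in> N" "m + n = x" "norm (m, n) \<le> C * norm x"
      using C[of x] UNIV by auto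
    then have "P x = n"
      by (intro uniq) auto
    then show ?thesis
      using mn(4) norm_snd_le[of n m] by (simp add: mult.commute)
  qed
  then have "bounded_linear P"
    using add scale by (intro bounded_linear_intro[where K = C]) (simp_all add: scaleR_scaleC)
  then have "bounded_projection P"
    using scale P(1) PN by (auto simp: bounded_projection_def bounded_clinear_def)
  then show thesis
    using comm P PN PM by (intro that[of P]) (auto simp: fun_eq_iff)
qed

lemma surjective_perturbation:
  fixes T :: "'a :: complex_banach \<Rightarrow> 'a"
  assumes T: "bounded_clinear T" and M: "closed_csubspace M" and surj: "T ` M = M"
  obtains e where "e > 0" "\<And>c. cmod c < e \<Longrightarrow> (\<lambda>x. T x - c *\<^sub>C x) ` M = M"
proof -
  note M' = closed_csubspaceD[OF M]
  obtain C where C: "C > 0" "\<And>y. y \<in> M \<Longrightarrow> \<exists>x\<in>M. T x = y \<and> norm x \<le> C * norm y"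
    using open_mapping_on[OF bounded_clinearD(1)[OF T] M'(3,1)] surj M'(1) by metis
  have "(\<lambda>x. T x - c *\<^sub>C x) ` M = M" if c: "cmod c < 1 / (2 * C)" for c
  proof -
    let ?S = "\<lambda>x. T x - c *\<^sub>C x"
    have sub: "?S ` M \<subseteq> M"
      using surj M'(2) by (auto intro!: complex_vector.subspace_diff complex_vector.subspace_scale)
    have "\<exists>x\<in>M. norm x \<le> C * norm y \<and> norm (y - ?S x) \<le> norm y / 2" if y: "y \<in> M" for y
    proof -
      obtain x where x: "x \<in> M" "T x = y" "norm x \<le> C * norm y"
        using C(2)[OF y] by blast
      have "norm (y - ?S x) = cmod c * norm x"
        using x by (simp add: norm_scaleC)
      also have "\<dots> \<le> 1 / (2 * C) * (C * norm y)"
        using c C(1) x by (intro mult_mono) auto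
      finally show ?thesis
        using x C(1) by auto
    qed
    then have "\<exists>x\<in>M. ?S x = y" if "y \<in> M" for y
      using approximate_solutions_imp_solution[OF bounded_clinearD(1)[OF bounded_clinear_shift[OF T]]
          M'(3,1) M'(3) sub, of C y] that by blast
    with sub show ?thesis
      by force
  qed
  with C(1) show thesis
    by (intro that[of "1 / (2 * C)"]) auto
qed

text \<open>The Neumann series \<open>- (\<Sum>n. c\<^sup>-\<^sup>n\<^sup>-\<^sup>1 T\<^sup>n y)\<close> solves \<open>(T - c) x = y\<close>.\<close>

lemma quasinilpotent_shift_surjective:
  fixes T :: "'a :: complex_banach \<Rightarrow> 'a"
  assumes T: "bounded_clinear T" and N: "closed_csubspace N" "T ` N \<subseteq> N"
    and qn: "N \<subseteq> quasinilpotent_part T" and c: "c \<noteq> 0"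
  shows "(\<lambda>x. T x - c *\<^sub>C x) ` N = N"
proof (intro equalityI subsetI)
  note N' = closed_csubspaceD[OF N(1)]
  fix y assume y: "y \<in> N"
  define u where "u n = (1 / c ^ Suc n) *\<^sub>C (T ^^ n) y" for n
  have uN: "u n \<in> N" for n
    using y N'(2) funpow_image_subset[OF N(2), of n]
    by (auto simp: u_def intro: complex_vector.subspace_scale)
  obtain C where C: "\<And>n. norm ((T ^^ n) y) \<le> C * (cmod c / 2) ^ n"
    using subsetD[OF qn y] c unfolding quasinilpotent_part_iff
    by (metis half_gt_zero zero_less_norm_iff)
  have "norm (u n) \<le> C / cmod c * (1/2) ^ n" for n
    using C[of n] c by (simp add: u_def norm_scaleC norm_divide norm_mult norm_power field_simps)
  then have "summable (\<lambda>n. norm (u n))"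
    by (intro summable_comparison_test[OF _ summable_mult[of _ "C / cmod c", OF summable_geometric[of "1/2::real"]]]) auto
  then have su: "summable u"
    by (rule summable_norm_cancel)
  define x where "x = - (\<Sum>n. u n)"
  have lim: "(\<lambda>n. - (\<Sum>i<n. u i)) \<longlonglongrightarrow> x"
    unfolding x_def using su by (intro tendsto_minus summable_LIMSEQ)
  have "x \<in> N"
    using uN N'(3) by (intro closed_sequentially[OF N'(1) _ lim]) (auto intro!: subspace_neg subspace_sum)
  moreover have "T x - c *\<^sub>C x = y"
  proof -
    interpret S: bounded_linear "\<lambda>x. T x - c *\<^sub>C x"
      using bounded_clinearD(1)[OF bounded_clinear_shift[OF T]] .
    have Tu: "T (u i) = c *\<^sub>C u (Suc i)" for i
      using c by (simp add: u_def bounded_clinearD[OF T] scaleC_scaleC)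
    have part: "T (- (\<Sum>i<n. u i)) - c *\<^sub>C (- (\<Sum>i<n. u i)) = y - c *\<^sub>C u n" for n
    proof (induction n)
      case 0
      then show ?case
        using c by (simp add: bounded_clinearD[OF T] u_def scaleC_scaleC scaleC_one)
    next
      case (Suc n)
      have "- (\<Sum>i<Suc n. u i) = - (\<Sum>i<n. u i) - u n"
        by simp
      then show ?case
        using Suc by (simp only: S.diff) (simp add: Tu)
    qed
    have "(\<lambda>n. y - c *\<^sub>C u n) \<longlonglongrightarrow> y - c *\<^sub>C 0"
      using bounded_linear.tendsto[OF bounded_clinearD(1)[OF bounded_clinear_scaleC] summable_LIMSEQ_zero[OF su]]
      by (intro tendsto_diff tendsto_const)
    moreover have "(\<lambda>n. y - c *\<^sub>C u n) \<longlonglongrightarrow> T x - c *\<^sub>C x"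
      using S.tendsto[OF lim] by (simp only: part)
    ultimately show ?thesis
      using LIMSEQ_unique by fastforce
  qed
  ultimately show "y \<in> (\<lambda>x. T x - c *\<^sub>C x) ` N"
    by blast
qed (use N closed_csubspaceD[OF N(1)] in
    \<open>auto intro!: complex_vector.subspace_diff complex_vector.subspace_scale\<close>)

subsection \<open>Analytical core and Kato operators\<close>

lemma analytical_core_subset_image:
  assumes T: "bounded_linear T"
  shows "analytical_core T \<subseteq> T ` analytical_core T"
proof
  interpret bounded_linear T
    by fact
  fix x assume "x \<in> analytical_core T"
  then obtain c u where c: "c > 0" and u: "T (u 1) = x"
    "\<And>n. n \<ge> 1 \<Longrightarrow> T (u (n + 1)) = u n" "\<And>n. n \<ge> 1 \<Longrightarrow> norm (u n) \<le> c ^ n * norm x"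
    by (auto simp: analytical_core_def)
  obtain K where K: "K > 0" "\<And>x. norm (T x) \<le> norm x * K"
    using pos_bounded by blast
  define d where "d = c * max 1 (c * K)"
  have d: "d > 0"
    using c by (simp add: d_def)
  have "norm (u (n + 1)) \<le> d ^ n * norm (u 1)" if n: "n \<ge> 1" for n
  proof -
    have "c * K \<le> max 1 (c * K) ^ n"
      using n by (meson max.cobounded1 max.cobounded2 order_trans self_le_power less_le_trans zero_less_one)
    then have "c ^ (n + 1) * K \<le> d ^ n"
      using c by (simp add: d_def power_mult_distrib mult_ac)
    then have "c ^ (n + 1) * K * norm (u 1) \<le> d ^ n * norm (u 1)"
      by (rule mult_right_mono) simp
    moreover have "c ^ (n + 1) * norm x \<le> c ^ (n + 1) * (norm (u 1) * K)"
      using K(2)[of "u 1"] u(1) c by (intro mult_left_mono) auto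
    ultimately show ?thesis
      using u(3)[of "n + 1"] by (simp add: mult_ac)
  qed
  then have "u 1 \<in> analytical_core T"
    using d u(2) unfolding analytical_core_def
    by (intro CollectI exI[of _ d] conjI exI[of _ "\<lambda>n. u (n + 1)"]) auto
  with u(1) show "x \<in> T ` analytical_core T"
    by blast
qed

lemma analytical_core_eq:
  fixes T :: "'a :: complex_banach \<Rightarrow> 'a"
  assumes T: "bounded_clinear T" and MN: "(M, N) \<in> Red T"
    and surj: "T ` M = M" and qn: "quasinilpotent_on N T"
  shows "analytical_core T = M"
proof (intro equalityI subsetI)
  note R = RedD[OF MN]
  note M = closed_csubspaceD[OF R(1)] and N = closed_csubspaceD[OF R(2)]
  fix x assume x: "x \<in> M"
  obtain C where C: "C > 0" "\<And>y. y \<in> M \<Longrightarrow> \<exists>x\<in>M. T x = y \<and> norm x \<le> C * norm y"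
    using open_mapping_on[OF bounded_clinearD(1)[OF T] M(3,1)] surj M(1) by metis
  then obtain g where g: "\<And>y. y \<in> M \<Longrightarrow> g y \<in> M \<and> T (g y) = y \<and> norm (g y) \<le> C * norm y"
    by metis
  have gM: "(g ^^ n) x \<in> M" for n
    using x g by (induction n) auto
  have "norm ((g ^^ n) x) \<le> C ^ n * norm x" for n
  proof (induction n)
    case (Suc n)
    have "norm ((g ^^ Suc n) x) \<le> C * norm ((g ^^ n) x)"
      using g gM by simp
    also have "\<dots> \<le> C * (C ^ n * norm x)"
      using Suc C(1) by (intro mult_left_mono) auto
    finally show ?case
      by (simp add: mult_ac)
  qed simp
  then show "x \<in> analytical_core T"
    unfolding analytical_core_def using C(1) g gM x
    by (intro CollectI exI[of _ C] conjI exI[of _ "\<lambda>n. (g ^^ n) x"]) auto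
next
  note R = RedD[OF MN]
  note M = closed_csubspaceD[OF R(1)] and N = closed_csubspaceD[OF R(2)]
  fix x assume "x \<in> analytical_core T"
  then obtain c u where c: "c > 0" and u: "T (u 1) = x"
    "\<And>n. n \<ge> 1 \<Longrightarrow> T (u (n + 1)) = u n" "\<And>n. n \<ge> 1 \<Longrightarrow> norm (u n) \<le> c ^ n * norm x"
    by (auto simp: analytical_core_def)
  obtain P where P: "bounded_projection P" "P \<circ> T = T \<circ> P" "\<And>x. P x \<in> N" "\<And>x. x - P x \<in> M"
    using Red_projection[OF T MN] by metis
  have bP: "bounded_clinear P"
    using P(1) by (simp add: bounded_projection_def)
  obtain K where K: "K > 0" "\<And>x. norm (P x) \<le> norm x * K"
    using bounded_linear.pos_bounded[OF bounded_clinearD(1)[OF bP]] by blast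
  have Tu: "(T ^^ n) (u n) = x" if "n \<ge> 1" for n
    using that
  proof (induction n rule: dec_induct)
    case (step n)
    then show ?case
      using u(2)[of n] by (simp add: funpow_swap1)
  qed (use u(1) in simp)
  have PT: "P ((T ^^ n) y) = (T ^^ n) (P y)" for n y
    using P(2) by (induction n) (auto simp: fun_eq_iff)
  obtain D where D: "D > 0" "\<And>n x. x \<in> N \<Longrightarrow> norm ((T ^^ n) x) \<le> D * (1 / (2 * c)) ^ n * norm x"
    using qn c unfolding quasinilpotent_on_iff_uniform[OF bounded_clinearD(1)[OF T] N(3,1)]
    by (metis divide_pos_pos mult_pos_pos zero_less_numeral zero_less_one)
  have "norm (P x) \<le> D * K * norm x * (1/2) ^ n" if n: "n \<ge> 1" for n
  proof -
    have "norm (P x) = norm ((T ^^ n) (P (u n)))"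
      using Tu[OF n] PT by metis
    also have "\<dots> \<le> D * (1 / (2 * c)) ^ n * norm (P (u n))"
      using D(2) P(3) by blast
    also have "\<dots> \<le> D * (1 / (2 * c)) ^ n * (c ^ n * norm x * K)"
      using D(1) c K order_trans[OF K(2) mult_right_mono[OF u(3)[OF n]]]
      by (intro mult_left_mono) auto
    also have "\<dots> = D * K * norm x * (1/2) ^ n"
      using c by (simp add: power_divide power_mult_distrib)
    finally show ?thesis .
  qed
  then have ev: "\<forall>\<^sub>F n in sequentially. norm (P x) \<le> D * K * norm x * (1/2) ^ n"
    by (auto simp: eventually_sequentially)
  have "(\<lambda>n. D * K * norm x * (1/2) ^ n) \<longlonglongrightarrow> 0"
    by (intro tendsto_mult_right_zero LIMSEQ_power_zero) simp
  then have "norm (P x) \<le> 0"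
    using ev by (rule tendsto_lowerbound) simp
  then show "x \<in> M"
    using P(4)[of x] by simp
qed

lemma Red_surj_iff:
  assumes T: "bounded_clinear T" and MN: "(M, N) \<in> Red T"
  shows "surj T \<longleftrightarrow> T ` M = M \<and> T ` N = N"
proof
  note R = RedD[OF MN]
  note M = closed_csubspaceD[OF R(1)] and N = closed_csubspaceD[OF R(2)]
  assume s: "surj T"
  have split: "m = T a \<and> n = T b" if "m \<in> M" "n \<in> N" "a \<in> M" "b \<in> N" "m + n = T (a + b)" for m n a b
  proof -
    have "m - T a = T b - n"
      using that(5) by (simp add: bounded_clinearD[OF T] algebra_simps)
    moreover have "m - T a \<in> M" "T b - n \<in> N"
      using that R(3,4) M(2) N(2) by (auto intro!: complex_vector.subspace_diff)
    ultimately have "m - T a \<in> M \<inter> N" "T b - n \<in> M \<inter> N"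
      by auto
    then show ?thesis
      using R(5) by auto
  qed
  have 0: "0 \<in> M" "0 \<in> N"
    using M(2) N(2) complex_vector.subspace_0 by auto
  have "\<exists>a\<in>M. \<exists>b\<in>N. x = T (a + b)" for x
    using s R(6) by (metis surjD)
  then have "m \<in> T ` M" "n \<in> T ` N" if "m \<in> M" "n \<in> N" for m n
    using split[OF that(1) 0(2)] split[OF 0(1) that(2)] by (metis add.right_neutral image_eqI, metis add.left_neutral image_eqI)
  with R(3,4) 0 show "T ` M = M \<and> T ` N = N"
    by blast
next
  assume "T ` M = M \<and> T ` N = N"
  then have "\<exists>a\<in>M. \<exists>b\<in>N. x = T (a + b)" for x
    using RedD(6)[OF MN, of x] by (auto simp: bounded_clinearD[OF T]) (metis imageE)
  then show "surj T"
    by (metis surj_def)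
qed

lemma Red_shift:
  assumes "(M, N) \<in> Red T"
  shows "(M, N) \<in> Red (\<lambda>x. T x - c *\<^sub>C x)"
proof -
  have "(\<lambda>x. T x - c *\<^sub>C x) ` Y \<subseteq> Y" if "closed_csubspace Y" "T ` Y \<subseteq> Y" for Y
    using that closed_csubspaceD(2)[OF that(1)]
    by (auto intro!: complex_vector.subspace_diff complex_vector.subspace_scale)
  with assms show ?thesis
    by (simp add: Red_iff)
qed

lemma Red_shift_surj:
  fixes T :: "'a :: complex_banach \<Rightarrow> 'a"
  assumes T: "bounded_clinear T" and MN: "(M, N) \<in> Red T"
    and surj: "T ` M = M" and qn: "N \<subseteq> quasinilpotent_part T"
  obtains e where "e > 0" "\<And>c. c \<noteq> 0 \<Longrightarrow> cmod c < e \<Longrightarrow> surj (\<lambda>x. T x - c *\<^sub>C x)"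
proof -
  note R = RedD[OF MN]
  obtain e where e: "e > 0" "\<And>c. cmod c < e \<Longrightarrow> (\<lambda>x. T x - c *\<^sub>C x) ` M = M"
    using surjective_perturbation[OF T R(1) surj] by metis
  have "surj (\<lambda>x. T x - c *\<^sub>C x)" if "c \<noteq> 0" "cmod c < e" for c
    using Red_surj_iff[OF bounded_clinear_shift[OF T] Red_shift[OF MN]] e(2) that
      quasinilpotent_shift_surjective[OF T R(2,4) qn] by simp
  with e(1) show thesis
    by (rule that)
qed

text \<open>With \<open>Y = (\<Inter>n. T\<^sup>n M)\<close> we have \<open>T Y = Y\<close> and \<open>ker T \<subseteq> Y\<close>, so \<open>T\<close> is bounded below modulo
  \<open>Y\<close>; hence solutions of \<open>(T - c) x = y\<close> stay bounded modulo \<open>Y\<close> as \<open>c \<rightarrow> 0\<close> and \<open>y\<close> is a limit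
  of elements of \<open>T M\<close>.\<close>

lemma Kato_surjective:
  fixes T :: "'a :: complex_banach \<Rightarrow> 'a"
  assumes T: "bounded_clinear T" and M: "closed_csubspace M" "T ` M \<subseteq> M" and K: "Kato_on M T"
    and surj: "\<And>e. e > 0 \<Longrightarrow> \<exists>c. cmod c < e \<and> (\<lambda>x. T x - c *\<^sub>C x) ` M = M"
  shows "T ` M = M"
proof (intro equalityI subsetI)
  note M' = closed_csubspaceD[OF M(1)]
  note lin = bounded_clinearD[OF T]
  have cl: "closed (T ` M)" and ker: "\<And>n x. x \<in> M \<Longrightarrow> T x = 0 \<Longrightarrow> x \<in> (T ^^ n) ` M"
    using K by (auto simp: Kato_on_def)
  define Y where "Y = (\<Inter>n. (T ^^ n) ` M)"
  have kerY: "x \<in> Y" if "x \<in> M" "T x = 0" for x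
    using ker that by (auto simp: Y_def)
  have Y: "complex_vector.subspace Y"
    unfolding Y_def
    by (intro complex_vector.subspace_Inter) (auto intro!: csubspace_image bounded_clinear_funpow T M')
  have YM: "Y \<subseteq> M" "Y \<subseteq> T ` M"
    unfolding Y_def using INT_lower[of 0 UNIV "\<lambda>n. (T ^^ n) ` M"] INT_lower[of 1 UNIV "\<lambda>n. (T ^^ n) ` M"]
    by auto
  have lift: "\<exists>z\<in>Y. T z = y" if y: "y \<in> Y" for y
  proof -
    obtain z where z: "z \<in> M" "T z = y"
      using y YM by auto
    have "z \<in> (T ^^ n) ` M" for n
    proof -
      have "y \<in> (T ^^ Suc n) ` M"
        using y unfolding Y_def by blast
      then obtain m where m: "m \<in> M" "y = T ((T ^^ n) m)"
        by auto
      have "(T ^^ n) m \<in> M"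
        using m(1) funpow_image_subset[OF M(2)] by blast
      then have "z - (T ^^ n) m \<in> (T ^^ n) ` M"
        using z m M'(2) by (intro ker) (auto simp: lin complex_vector.subspace_diff)
      then have "(z - (T ^^ n) m) + (T ^^ n) m \<in> (T ^^ n) ` M"
        using m(1) csubspace_image[OF bounded_clinear_funpow[OF T] M'(2)]
        by (intro complex_vector.subspace_add) auto
      then show ?thesis
        by simp
    qed
    then show ?thesis
      using z by (auto simp: Y_def)
  qed
  obtain C where C: "C > 0" "\<And>y. y \<in> T ` M \<Longrightarrow> \<exists>x\<in>M. T x = y \<and> norm x \<le> C * norm y"
    using open_mapping_on[OF lin(1) M'(3,1) cl] by metis
  have below: "\<exists>z\<in>Y. norm (x - z) \<le> C * norm (T x - y)" if x: "x \<in> M" and y: "y \<in> Y" for x y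
  proof -
    obtain v where v: "v \<in> Y" "T v = y"
      using lift[OF y] by blast
    have "x - v \<in> M"
      using x v YM M'(2) by (auto intro: complex_vector.subspace_diff)
    then have "T x - y \<in> T ` M"
      using v by (auto simp: lin intro!: image_eqI[of _ _ "x - v"])
    then obtain w where w: "w \<in> M" "T w = T x - y" "norm w \<le> C * norm (T x - y)"
      using C(2) by blast
    have "x - v - w \<in> Y"
      using \<open>x - v \<in> M\<close> v w M'(2) by (intro kerY) (auto simp: lin intro: complex_vector.subspace_diff)
    then have "(x - v - w) + v \<in> Y"
      using Y v(1) complex_vector.subspace_add by blast
    then show ?thesis
      using w(3) by (intro bexI[of _ "x - w"]) (simp_all add: algebra_simps)
  qed
  fix y assume y: "y \<in> M"
  have "\<exists>t\<in>T ` M. dist t y < e" if e: "e > 0" for e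
  proof -
    define b where "b = min (1 / (2 * C)) (e / (2 * C * norm y + 2))"
    have pos: "2 * C * norm y + 2 > 0"
      using C(1) by (simp add: add_nonneg_pos)
    then have "b > 0"
      using C(1) e by (simp add: b_def)
    then obtain c where c: "cmod c < b" and cM: "(\<lambda>x. T x - c *\<^sub>C x) ` M = M"
      using surj by blast
    have "cmod c * C \<le> 1 / (2 * C) * C"
      using c C(1) by (intro mult_right_mono) (auto simp: b_def)
    then have cC: "cmod c * C \<le> 1 / 2"
      using C(1) by simp
    obtain x where x: "x \<in> M" "y = T x - c *\<^sub>C x"
      using y cM by blast
    have "\<exists>z\<in>Y. norm (x - z) \<le> 2 * C * norm y + norm x * (1/2) ^ n" for n
    proof (induction n)
      case 0
      then show ?case
        using Y C(1) by (intro bexI[of _ 0]) (auto simp: complex_vector.subspace_0)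
    next
      case (Suc n)
      then obtain z where z: "z \<in> Y" "norm (x - z) \<le> 2 * C * norm y + norm x * (1/2) ^ n"
        by blast
      have "c *\<^sub>C z \<in> Y"
        using Y z(1) complex_vector.subspace_scale by blast
      then obtain z' where z': "z' \<in> Y" "norm (x - z') \<le> C * norm (T x - c *\<^sub>C z)"
        using below[OF x(1)] by blast
      have "T x - c *\<^sub>C z = y + c *\<^sub>C (x - z)"
        by (simp add: x(2) complex_vector.scale_right_diff_distrib)
      then have "norm (T x - c *\<^sub>C z) \<le> norm y + cmod c * norm (x - z)"
        by (metis norm_triangle_ineq norm_scaleC)
      then have "C * norm (T x - c *\<^sub>C z) \<le> C * (norm y + cmod c * norm (x - z))"
        using C(1) by (intro mult_left_mono) auto
      also have "\<dots> = C * norm y + (cmod c * C) * norm (x - z)"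
        by (simp add: algebra_simps)
      also have "\<dots> \<le> C * norm y + 1 / 2 * norm (x - z)"
        using cC by (intro add_left_mono mult_right_mono) auto
      finally show ?case
        using z z' by (intro bexI[of _ z']) auto
    qed
    moreover obtain n where "norm x * (1/2) ^ n < 1"
    proof -
      have "(\<lambda>n. norm x * (1/2) ^ n) \<longlonglongrightarrow> 0"
        by (intro tendsto_mult_right_zero LIMSEQ_power_zero) simp
      then have "\<forall>\<^sub>F n in sequentially. norm x * (1/2) ^ n < 1"
        by (rule order_tendstoD) simp
      then show thesis
        using that by (auto simp: eventually_sequentially)
    qed
    ultimately obtain z where z: "z \<in> Y" "norm (x - z) \<le> 2 * C * norm y + 1"
      by (meson add_left_mono less_imp_le order_trans)
    have "y + c *\<^sub>C (x - z) = T x - c *\<^sub>C z"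
      by (simp add: x(2) complex_vector.scale_right_diff_distrib)
    also have "\<dots> \<in> T ` M"
      using csubspace_image[OF T M'(2)] YM x(1) z(1)
      by (intro complex_vector.subspace_diff complex_vector.subspace_scale) auto
    finally have "y + c *\<^sub>C (x - z) \<in> T ` M" .
    moreover have "dist (y + c *\<^sub>C (x - z)) y < e"
    proof -
      have "dist (y + c *\<^sub>C (x - z)) y = cmod c * norm (x - z)"
        by (simp add: dist_norm norm_scaleC)
      also have "\<dots> \<le> cmod c * (2 * C * norm y + 2)"
        using z(2) by (intro mult_left_mono) auto
      also have "\<dots> < e"
        using c pos by (simp add: b_def pos_less_divide_eq)
      finally show ?thesis .
    qed
    ultimately show ?thesis
      by blast
  qed
  then have "y \<in> closure (T ` M)"
    by (auto simp: closure_approachable)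
  with cl show "y \<in> T ` M"
    by simp
qed (use M(2) in blast)

subsection \<open>Lower semi-Browder operators\<close>

lemma closed_csubspace_span_insert:
  fixes V :: "'a :: complex_banach set"
  assumes V: "closed_csubspace V"
  shows "closed_csubspace (complex_vector.span (insert x V))"
proof -
  note V' = closed_csubspaceD[OF V]
  have sV: "complex_vector.span V = V"
    using V'(2) by (simp add: complex_vector.span_eq_iff)
  have eq: "complex_vector.span (insert x V) = {y. \<exists>k. y - k *\<^sub>C x \<in> V}"
    by (simp add: complex_vector.span_insert sV)
  have "closed {y. \<exists>k. y - k *\<^sub>C x \<in> V}"
  proof (cases "x \<in> V")
    case True
    then have "complex_vector.span (insert x V) = V"
      by (simp add: insert_absorb sV)
    then show ?thesis
      using V'(1) eq by simp
  next
    case False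
    then obtain d where d: "d > 0" "\<And>v. v \<in> V \<Longrightarrow> d \<le> dist v x"
      using V'(1) by (metis closed_approachable not_le)
    have bd: "cmod k * d \<le> norm (v - k *\<^sub>C x)" if v: "v \<in> V" for v k
    proof (cases "k = 0")
      case False
      have "d \<le> dist ((1 / k) *\<^sub>C v) x"
        using v V'(2) by (intro d) (rule complex_vector.subspace_scale)
      then have "cmod k * d \<le> norm (k *\<^sub>C ((1 / k) *\<^sub>C v - x))"
        by (simp add: dist_norm norm_scaleC mult_left_mono)
      then show ?thesis
        using False by (simp add: complex_vector.scale_right_diff_distrib scaleC_scaleC scaleC_one)
    qed simp
    show ?thesis
    proof (subst closed_sequential_limits, intro allI impI, elim conjE)
      fix y l assume y: "\<forall>n. y n \<in> {y. \<exists>k. y - k *\<^sub>C x \<in> V}" and lim: "y \<longlonglongrightarrow> l"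
      obtain k where k: "\<And>n. y n - k n *\<^sub>C x \<in> V"
        using y by simp metis
      have "Cauchy k"
      proof (rule metric_CauchyI)
        fix e :: real assume e: "e > 0"
        obtain m where m: "\<And>i j. i \<ge> m \<Longrightarrow> j \<ge> m \<Longrightarrow> dist (y i) (y j) < e * d"
          using LIMSEQ_imp_Cauchy[OF lim] e d(1) by (metis metric_CauchyD mult_pos_pos)
        have "dist (k i) (k j) < e" if "i \<ge> m" "j \<ge> m" for i j
        proof -
          have "(y j - k j *\<^sub>C x) - (y i - k i *\<^sub>C x) \<in> V"
            using complex_vector.subspace_diff[OF V'(2) k k] .
          then have "cmod (k i - k j) * d \<le> norm ((y j - k j *\<^sub>C x) - (y i - k i *\<^sub>C x) - (k i - k j) *\<^sub>C x)"
            by (rule bd)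
          also have "\<dots> = dist (y i) (y j)"
            by (simp add: dist_norm complex_vector.scale_left_diff_distrib norm_minus_commute)
          finally show ?thesis
            using m[OF that] d(1) by (simp add: dist_norm) (metis le_less_trans mult_less_cancel_right_pos)
        qed
        then show "\<exists>m. \<forall>i\<ge>m. \<forall>j\<ge>m. dist (k i) (k j) < e"
          by blast
      qed
      then obtain a where a: "k \<longlonglongrightarrow> a"
        using Cauchy_convergent convergent_def by blast
      have "bounded_linear (\<lambda>k. k *\<^sub>C x)"
        by (rule bounded_linear_intro[where K = "norm x"])
          (simp_all add: scaleC_add_left norm_scaleC scaleR_scaleC[of _ x] scaleC_scaleC
            scaleR_scaleC[of _ "_ *\<^sub>C x"] scaleR_conv_of_real)
      then have "(\<lambda>n. y n - k n *\<^sub>C x) \<longlonglongrightarrow> l - a *\<^sub>C x"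
        by (intro tendsto_diff lim bounded_linear.tendsto[OF _ a])
      then have "l - a *\<^sub>C x \<in> V"
        by (rule closed_sequentially[OF V'(1) k])
      then show "l \<in> {y. \<exists>k. y - k *\<^sub>C x \<in> V}"
        by blast
    qed
  qed
  then show ?thesis
    by (simp add: closed_csubspace_def eq complex_vector.subspace_span flip: eq)
qed

lemma closed_csubspace_span_Un_finite:
  fixes V :: "'a :: complex_banach set"
  assumes V: "closed_csubspace V" and "finite C"
  shows "closed_csubspace (complex_vector.span (V \<union> C))"
  using \<open>finite C\<close>
proof (induction C)
  case empty
  then show ?case
    using V closed_csubspaceD(2)[OF V] by (simp add: complex_vector.span_eq_iff[THEN iffD2])
next
  case (insert x C)
  have "complex_vector.span (V \<union> insert x C) = complex_vector.span (insert x (complex_vector.span (V \<union> C)))"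
    by (simp add: complex_vector.span_insert complex_vector.span_span)
  then show ?case
    using closed_csubspace_span_insert[OF insert.IH] by simp
qed

text \<open>An operator range with a closed algebraic complement is closed: by openness of
  \<open>(x, f) \<mapsto> S x + f\<close>, the complementary component depends continuously on the vector.\<close>

lemma closed_image_if_closed_complement:
  fixes S :: "'a :: banach \<Rightarrow> 'b :: banach"
  assumes S: "bounded_linear S" and V: "subspace V" "closed V" and F: "subspace F" "closed F"
    and M: "closed M" "M = {S x + f | x f. x \<in> V \<and> f \<in> F}" and disj: "S ` V \<inter> F \<subseteq> {0}"
  shows "closed (S ` V)"
proof (subst closed_sequential_limits, intro allI impI, elim conjE)
  interpret S: bounded_linear S
    by fact
  let ?f = "\<lambda>z. S (fst z) + snd z"
  have M': "M = ?f ` (V \<times> F)"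
    unfolding M(2) by force
  have VF: "S ` V \<subseteq> M"
    unfolding M(2) using F(1) subspace_0 by force
  obtain C where C: "C > 0" "\<And>y. y \<in> ?f ` (V \<times> F) \<Longrightarrow> \<exists>z\<in>V \<times> F. ?f z = y \<and> norm z \<le> C * norm y"
  proof (rule open_mapping_on[of ?f "V \<times> F"])
    show "bounded_linear ?f"
      by (intro bounded_linear_add bounded_linear_compose[OF S] bounded_linear_fst bounded_linear_snd)
    show "closed (?f ` (V \<times> F))"
      using M(1) M' by simp
  qed (use V F in \<open>auto intro: closed_Times subspace_Times\<close>)
  fix y l assume y: "\<forall>n. y n \<in> S ` V" and lim: "y \<longlonglongrightarrow> l"
  have "l \<in> M"
    using closed_sequentially[OF M(1) _ lim] y VF by blast
  then obtain x f where xf: "x \<in> V" "f \<in> F" "l = S x + f"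
    unfolding M(2) by blast
  have bd: "norm f \<le> C * norm (y n - l)" for n
  proof -
    obtain v where v: "v \<in> V" "y n = S v"
      using y by blast
    have "(v - x, - f) \<in> V \<times> F"
      using v xf V F by (auto intro: subspace_diff subspace_neg)
    then have "y n - l \<in> ?f ` (V \<times> F)"
      by (intro image_eqI[of _ _ "(v - x, - f)"]) (simp_all add: v xf S.diff)
    then obtain u g where ug: "u \<in> V" "g \<in> F" "S u + g = y n - l" "norm (u, g) \<le> C * norm (y n - l)"
      using C(2) by fastforce
    have "g + f = S (v - x - u)"
      using ug(3) by (simp add: v xf S.diff S.add algebra_simps)
    moreover have "v - x - u \<in> V" "g + f \<in> F"
      using v xf ug V F by (auto intro: subspace_diff subspace_add)
    ultimately have "g + f = 0"
      using disj by auto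
    then have "norm f = norm g"
      by (metis add_eq_0_iff norm_minus_cancel)
    then show ?thesis
      using ug(4) norm_snd_le[of g u] by simp
  qed
  have "(\<lambda>n. C * norm (y n - l)) \<longlonglongrightarrow> 0"
    using lim by (intro tendsto_mult_right_zero tendsto_norm_zero) (simp add: LIM_zero_iff)
  then have "norm f \<le> 0"
    by (rule tendsto_lowerbound) (use bd in auto)
  then show "l \<in> S ` V"
    using xf by simp
qed

lemma span_exchange:
  assumes "finite B" "y \<in> complex_vector.span (S \<union> B)" "y \<notin> complex_vector.span S"
  shows "\<exists>b\<in>B. b \<in> complex_vector.span (insert y (S \<union> (B - {b})))"
  using assms
proof (induction B)
  case (insert b B)
  show ?case
  proof (cases "y \<in> complex_vector.span (S \<union> B)")
    case True
    then obtain c where c: "c \<in> B" "c \<in> complex_vector.span (insert y (S \<union> (B - {c})))"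
      using insert by blast
    moreover have "complex_vector.span (insert y (S \<union> (B - {c}))) \<subseteq>
        complex_vector.span (insert y (S \<union> (insert b B - {c})))"
      by (intro complex_vector.span_mono) auto
    ultimately show ?thesis
      by blast
  next
    case False
    have "y \<in> complex_vector.span (insert b (S \<union> B))"
      using insert.prems(1) by simp
    then have "b \<in> complex_vector.span (insert y (S \<union> B))"
      using False by (rule complex_vector.in_span_insert)
    moreover have "insert b B - {b} = B"
      using insert.hyps by auto
    ultimately show ?thesis
      by (intro bexI[of _ b]) simp_all
  qed
qed simp

lemma span_image_subset:
  assumes T: "bounded_clinear T" and V: "complex_vector.subspace V" and "T ` S \<subseteq> V"
  shows "T ` complex_vector.span S \<subseteq> V"
proof -
  note lin = bounded_clinearD[OF T]
  have "complex_vector.subspace (T -` V)"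
    using V unfolding complex_vector.subspace_def by (auto simp: lin)
  then have "complex_vector.span S \<subseteq> T -` V"
    using assms(3) by (intro complex_vector.span_minimal) auto
  then show ?thesis
    by blast
qed

text \<open>The complement is built one vector at a time. A vector \<open>z\<close> outside \<open>span (R \<union> C)\<close> with
  \<open>T z\<close> inside exists by nilpotency modulo \<open>R\<close>; since \<open>T R = R\<close> it can be corrected by an element of
  \<open>R\<close> so that \<open>T z \<in> span C\<close>.\<close>

lemma invariant_complement_extend:
  assumes T: "bounded_clinear T" and M: "complex_vector.subspace M" "T ` M \<subseteq> M"
    and R: "complex_vector.subspace R" "R \<subseteq> M" "T ` R = R" and p: "(T ^^ p) ` M \<subseteq> R"
    and "finite C" "C \<subseteq> M" "T ` complex_vector.span C \<subseteq> complex_vector.span C"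
      "R \<inter> complex_vector.span C \<subseteq> {0}"
    and "finite B" "complex_vector.span (R \<union> C \<union> B) = M"
  shows "\<exists>C. finite C \<and> C \<subseteq> M \<and> T ` complex_vector.span C \<subseteq> complex_vector.span C \<and>
    R \<inter> complex_vector.span C \<subseteq> {0} \<and> complex_vector.span (R \<union> C) = M"
  using assms(8-)
proof (induction "card B" arbitrary: B C rule: less_induct)
  case less
  note lin = bounded_clinearD[OF T]
  let ?W = "complex_vector.span (R \<union> C)"
  have W: "complex_vector.subspace ?W" and WM: "?W \<subseteq> M"
    using R(2) less.prems(2) M(1) by (simp_all add: complex_vector.span_minimal)
  have WI: "x \<in> ?W \<longleftrightarrow> (\<exists>r f. x = r + f \<and> r \<in> R \<and> f \<in> complex_vector.span C)" for x
    using R(1) unfolding complex_vector.span_Un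
    by (auto simp only: complex_vector.span_eq_iff[THEN iffD2])
  have RW: "R \<subseteq> ?W" and CW: "complex_vector.span C \<subseteq> ?W"
    by (auto intro: complex_vector.span_base complex_vector.span_mono[THEN subsetD])
  show ?case
  proof (cases "?W = M")
    case True
    with less.prems show ?thesis
      by blast
  next
    case False
    then obtain x where x: "x \<in> M" "x \<notin> ?W"
      using WM by blast
    define k where "k = (LEAST k. (T ^^ k) x \<in> ?W)"
    have "(T ^^ p) x \<in> ?W"
      using x(1) p RW by blast
    then have k: "(T ^^ k) x \<in> ?W"
      unfolding k_def by (rule LeastI)
    have "k \<noteq> 0"
      using k x(2) by (metis funpow_0)
    then obtain j where j: "k = Suc j"
      using not0_implies_Suc by blast
    define z where "z = (T ^^ j) x"
    have zW: "z \<notin> ?W"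
      using not_less_Least[of j "\<lambda>k. (T ^^ k) x \<in> ?W"] j by (simp add: z_def k_def)
    have zM: "z \<in> M"
      using x(1) funpow_image_subset[OF M(2)] by (auto simp: z_def)
    obtain r f where rf: "T z = r + f" "r \<in> R" "f \<in> complex_vector.span C"
      using k j WI[of "T z"] by (auto simp: z_def)
    obtain s where s: "s \<in> R" "T s = r"
      using R(3) rf(2) by (metis imageE)
    define y where "y = z - s"
    have yM: "y \<in> M"
      using zM s R(2) M(1) by (auto simp: y_def intro: complex_vector.subspace_diff)
    have yW: "y \<notin> ?W"
    proof
      assume "y \<in> ?W"
      then have "y + s \<in> ?W"
        using s(1) RW W by (blast intro: complex_vector.subspace_add)
      with zW show False
        by (simp add: y_def)
    qed
    have Ty: "T y \<in> complex_vector.span C"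
      using rf s by (simp add: y_def lin)
    obtain b where b: "b \<in> B" "b \<in> complex_vector.span (insert y (R \<union> C \<union> (B - {b})))"
      using span_exchange[OF less.prems(5) _ yW] yM less.prems(6) by blast
    show ?thesis
    proof (rule less.hyps[of "B - {b}" "insert y C"])
      show "card (B - {b}) < card B" "finite (B - {b})"
        using card_Diff1_less[OF less.prems(5) b(1)] less.prems(5) by simp_all
      show "finite (insert y C)" "insert y C \<subseteq> M"
        using less.prems yM by auto
      have "complex_vector.span C \<subseteq> complex_vector.span (insert y C)"
        by (intro complex_vector.span_mono) auto
      then show "T ` complex_vector.span (insert y C) \<subseteq> complex_vector.span (insert y C)"
        using Ty less.prems(3) complex_vector.span_superset[of C]
        by (intro span_image_subset[OF T]) auto
      show "R \<inter> complex_vector.span (insert y C) \<subseteq> {0}"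
      proof
        fix v assume v: "v \<in> R \<inter> complex_vector.span (insert y C)"
        then obtain a where a: "v - a *\<^sub>C y \<in> complex_vector.span C"
          by (auto simp: complex_vector.span_insert)
        have "v - (v - a *\<^sub>C y) \<in> ?W"
          by (rule complex_vector.subspace_diff[OF W]) (use a v RW CW in auto)
        then have "a *\<^sub>C y \<in> ?W"
          by simp
        then have "(1 / a) *\<^sub>C a *\<^sub>C y \<in> ?W"
          using W by (rule complex_vector.subspace_scale[rotated])
        then have "a = 0"
          using yW by (cases "a = 0") (simp_all add: scaleC_scaleC scaleC_one)
        with a v less.prems(4) show "v \<in> {0}"
          by auto
      qed
      show "complex_vector.span (R \<union> insert y C \<union> (B - {b})) = M"
      proof
        have "R \<union> insert y C \<union> (B - {b}) \<subseteq> M"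
          using R(2) less.prems(2,6) yM complex_vector.span_superset[of "R \<union> C \<union> B"] by auto
        then show "complex_vector.span (R \<union> insert y C \<union> (B - {b})) \<subseteq> M"
          using M(1) by (rule complex_vector.span_minimal)
        have "R \<union> C \<union> B \<subseteq> complex_vector.span (R \<union> insert y C \<union> (B - {b}))"
          using b(2) complex_vector.span_superset[of "R \<union> insert y C \<union> (B - {b})"] by auto
        then show "M \<subseteq> complex_vector.span (R \<union> insert y C \<union> (B - {b}))"
          unfolding less.prems(6)[symmetric]
          by (intro complex_vector.span_minimal complex_vector.subspace_span)
      qed
    qed
  qed
qed

lemma lower_semi_Browder_on_iff:
  "lower_semi_Browder_on Y S \<longleftrightarrow>
    (\<exists>B. finite B \<and> B \<subseteq> Y \<and> complex_vector.span (S ` Y \<union> B) = Y) \<and>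
    (\<exists>n. (S ^^ n) ` Y = (S ^^ (n + 1)) ` Y)"
  unfolding lower_semi_Browder_on_def lower_semi_Fredholm_on_def codim_in_def descent_on_def INF_less_iff
  by (simp add: conj_assoc)

lemma lower_semi_Browder_on_surj:
  assumes "complex_vector.subspace Y" "S ` Y = Y"
  shows "lower_semi_Browder_on Y S"
  unfolding lower_semi_Browder_on_iff using assms
  by (auto simp: complex_vector.span_eq_iff[THEN iffD2] intro!: exI[of _ "{}"] exI[of _ "0::nat"])

lemma finite_codim_funpow:
  assumes T: "bounded_clinear T" and M: "complex_vector.subspace M" "T ` M \<subseteq> M"
    and B: "finite B" "B \<subseteq> M" "complex_vector.span (T ` M \<union> B) = M"
  shows "\<exists>C. finite C \<and> C \<subseteq> M \<and> complex_vector.span ((T ^^ n) ` M \<union> C) = M"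
proof (induction n)
  case 0
  then show ?case
    using M(1) by (auto simp: complex_vector.span_eq_iff[THEN iffD2] intro!: exI[of _ "{}"])
next
  case (Suc n)
  then obtain C where C: "finite C" "C \<subseteq> M" "complex_vector.span ((T ^^ n) ` M \<union> C) = M"
    by blast
  let ?D = "T ` C \<union> B" and ?V = "(T ^^ Suc n) ` M"
  have D: "finite ?D" "?D \<subseteq> M"
    using B(1,2) C(1,2) M(2) by (auto dest: subsetD)
  have "T ` M = T ` complex_vector.span ((T ^^ n) ` M \<union> C)"
    by (simp add: C(3))
  also have "\<dots> \<subseteq> complex_vector.span (?V \<union> ?D)"
    using complex_vector.span_superset[of "?V \<union> ?D"]
    by (intro span_image_subset[OF T]) (auto simp: funpow_image_Suc simp del: funpow.simps(2))
  finally have "T ` M \<union> B \<subseteq> complex_vector.span (?V \<union> ?D)"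
    using complex_vector.span_superset[of "?V \<union> ?D"] by auto
  then have "M \<subseteq> complex_vector.span (?V \<union> ?D)"
    using complex_vector.span_minimal[of "T ` M \<union> B" "complex_vector.span (?V \<union> ?D)"] B(3) by simp
  moreover have "complex_vector.span (?V \<union> ?D) \<subseteq> M"
    using D(2) funpow_image_subset[OF M(2)] M(1) by (intro complex_vector.span_minimal) blast+
  ultimately show ?case
    using D by blast
qed

lemma csubspace_quasinilpotent_part:
  assumes T: "bounded_clinear T"
  shows "complex_vector.subspace (quasinilpotent_part T)"
  unfolding complex_vector.subspace_def
proof (intro conjI ballI allI)
  note lin = bounded_clinearD[OF bounded_clinear_funpow[OF T]]
  show "0 \<in> quasinilpotent_part T"
    by (auto simp: quasinilpotent_part_iff lin intro: exI[of _ 1])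
  show "x + y \<in> quasinilpotent_part T" if xy: "x \<in> quasinilpotent_part T" "y \<in> quasinilpotent_part T" for x y
    unfolding quasinilpotent_part_iff
  proof (intro allI impI)
    fix e :: real assume "e > 0"
    then obtain C D where C: "C > 0" "\<And>n. norm ((T ^^ n) x) \<le> C * e ^ n"
      and D: "D > 0" "\<And>n. norm ((T ^^ n) y) \<le> D * e ^ n"
      using xy unfolding quasinilpotent_part_iff by metis
    have "norm ((T ^^ n) (x + y)) \<le> (C + D) * e ^ n" for n
      using norm_triangle_ineq[of "(T ^^ n) x" "(T ^^ n) y"] C(2)[of n] D(2)[of n]
      by (simp add: lin distrib_right)
    with C(1) D(1) show "\<exists>C>0. \<forall>n. norm ((T ^^ n) (x + y)) \<le> C * e ^ n"
      by (intro exI[of _ "C + D"]) auto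
  qed
  show "c *\<^sub>C x \<in> quasinilpotent_part T" if x: "x \<in> quasinilpotent_part T" for c x
    unfolding quasinilpotent_part_iff
  proof (intro allI impI)
    fix e :: real assume "e > 0"
    then obtain C where C: "C > 0" "\<And>n. norm ((T ^^ n) x) \<le> C * e ^ n"
      using x unfolding quasinilpotent_part_iff by metis
    have "norm ((T ^^ n) (c *\<^sub>C x)) \<le> ((cmod c + 1) * C) * e ^ n" for n
    proof -
      have "norm ((T ^^ n) (c *\<^sub>C x)) \<le> (cmod c + 1) * (C * e ^ n)"
        unfolding lin norm_scaleC using C(2)[of n] by (intro mult_mono) auto
      then show ?thesis
        by (simp add: mult.assoc)
    qed
    moreover have "(cmod c + 1) * C > 0"
      using C(1) by (intro mult_pos_pos add_nonneg_pos) auto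
    ultimately show "\<exists>C>0. \<forall>n. norm ((T ^^ n) (c *\<^sub>C x)) \<le> C * e ^ n"
      by blast
  qed
qed

lemma nilpotent_imp_quasinilpotent_part:
  assumes T: "bounded_clinear T" and "(T ^^ p) x = 0"
  shows "x \<in> quasinilpotent_part T"
proof -
  have "(T ^^ n) x = 0" if "n \<ge> p" for n
    using assms that by (metis bounded_clinearD(5) bounded_clinear_funpow funpow_add le_add_diff_inverse2 o_apply)
  then have "\<forall>\<^sub>F n in sequentially. root n (norm ((T ^^ n) x)) = 0"
    unfolding eventually_sequentially by (intro exI[of _ p]) simp
  then show ?thesis
    by (simp add: quasinilpotent_part_def tendsto_eventually)
qed

lemma lower_semi_Browder_decomposition:
  fixes T :: "'a :: complex_banach \<Rightarrow> 'a"
  assumes T: "bounded_clinear T" and MN: "(M, N) \<in> Red T"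
    and Br: "lower_semi_Browder_on M T" and qn: "N \<subseteq> quasinilpotent_part T"
  obtains R N' where "(R, N') \<in> Red T" "T ` R = R" "N' \<subseteq> quasinilpotent_part T"
proof -
  note Rd = RedD[OF MN]
  note M = closed_csubspaceD[OF Rd(1)] and N = closed_csubspaceD[OF Rd(2)]
  obtain B p where B: "finite B" "B \<subseteq> M" "complex_vector.span (T ` M \<union> B) = M"
    and p: "(T ^^ p) ` M = (T ^^ (p + 1)) ` M"
    using Br unfolding lower_semi_Browder_on_iff by metis
  define R where "R = (T ^^ p) ` M"
  have R: "complex_vector.subspace R" "R \<subseteq> M" "T ` R = R"
    using csubspace_image[OF bounded_clinear_funpow[OF T] M(2)] funpow_image_subset[OF Rd(3)] p
    by (simp_all add: R_def funpow_image_Suc del: funpow.simps(2))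
  obtain B' where B': "finite B'" "B' \<subseteq> M" "complex_vector.span (R \<union> B') = M"
    using finite_codim_funpow[OF T M(2) Rd(3) B] unfolding R_def by metis
  have "\<exists>C. finite C \<and> C \<subseteq> M \<and> T ` complex_vector.span C \<subseteq> complex_vector.span C \<and>
      R \<inter> complex_vector.span C \<subseteq> {0} \<and> complex_vector.span (R \<union> C) = M"
  proof (rule invariant_complement_extend[OF T M(2) Rd(3) R])
    show "(T ^^ p) ` M \<subseteq> R"
      by (simp add: R_def)
    show "finite {}" "finite B'" "complex_vector.span (R \<union> {} \<union> B') = M"
      using B' by auto
  qed (auto simp: bounded_clinearD[OF T])
  then obtain C where C: "finite C" "C \<subseteq> M" "T ` complex_vector.span C \<subseteq> complex_vector.span C"
      "R \<inter> complex_vector.span C \<subseteq> {0}" "complex_vector.span (R \<union> C) = M"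
    by blast
  let ?F = "complex_vector.span C"
  have "closed_csubspace {0 :: 'a}"
    by (simp add: closed_csubspace_def)
  from closed_csubspace_span_Un_finite[OF this C(1)] have F: "closed_csubspace ?F"
    by simp
  note F' = closed_csubspaceD[OF F]
  have FM: "?F \<subseteq> M"
    using C(2) M(2) by (rule complex_vector.span_minimal)
  have sR: "complex_vector.span R = R" and sN: "complex_vector.span N = N"
    using R(1) N(2) by (simp_all add: complex_vector.span_eq_iff)
  have MRF: "M = {r + f | r f. r \<in> R \<and> f \<in> ?F}"
    using C(5) by (simp add: complex_vector.span_Un sR)
  have "closed R"
    unfolding R_def
  proof (rule closed_image_if_closed_complement[OF _ M(3,1) F'(3,1) M(1)])
    show "bounded_linear (T ^^ p)"
      using bounded_clinearD(1)[OF bounded_clinear_funpow[OF T]] .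
    show "M = {(T ^^ p) x + f |x f. x \<in> M \<and> f \<in> ?F}"
      by (subst MRF) (auto simp: R_def)
    show "(T ^^ p) ` M \<inter> ?F \<subseteq> {0}"
      using C(4) by (simp add: R_def)
  qed
  have N'eq: "complex_vector.span (N \<union> C) = {n + f | n f. n \<in> N \<and> f \<in> ?F}"
    by (simp add: complex_vector.span_Un sN)
  have Fq: "f \<in> quasinilpotent_part T" if f: "f \<in> ?F" for f
  proof (rule nilpotent_imp_quasinilpotent_part[OF T])
    have "(T ^^ p) f \<in> ?F" "(T ^^ p) f \<in> R"
      using f FM funpow_image_subset[OF C(3), of p] by (auto simp: R_def)
    then show "(T ^^ p) f = 0"
      using C(4) by blast
  qed
  show thesis
  proof (rule that[of R "complex_vector.span (N \<union> C)"])
    show "(R, complex_vector.span (N \<union> C)) \<in> Red T"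
      unfolding Red_iff
    proof (intro conjI allI)
      show "closed_csubspace R"
        using \<open>closed R\<close> R(1) by (simp add: closed_csubspace_def)
      show "closed_csubspace (complex_vector.span (N \<union> C))"
        by (rule closed_csubspace_span_Un_finite[OF Rd(2) C(1)])
      show "T ` R \<subseteq> R"
        using R(3) by simp
      show "T ` complex_vector.span (N \<union> C) \<subseteq> complex_vector.span (N \<union> C)"
        unfolding N'eq using Rd(4) C(3) by (fastforce simp: bounded_clinearD[OF T])
      show "R \<inter> complex_vector.span (N \<union> C) \<subseteq> {0}"
      proof
        fix r assume "r \<in> R \<inter> complex_vector.span (N \<union> C)"
        then obtain n f where nf: "r \<in> R" "r = n + f" "n \<in> N" "f \<in> ?F"
          unfolding N'eq by blast
        have "r - f \<in> M"
          using nf(1,4) R(2) FM by (intro complex_vector.subspace_diff[OF M(2)]) auto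
        then have "n = 0"
          using nf(2,3) Rd(5) by auto
        with nf C(4) show "r \<in> {0}"
          by auto
      qed
      show "\<exists>m\<in>R. \<exists>n\<in>complex_vector.span (N \<union> C). x = m + n" for x
      proof -
        obtain m n where mn: "m \<in> M" "n \<in> N" "x = m + n"
          using Rd(6) by blast
        then obtain r f where "r \<in> R" "f \<in> ?F" "m = r + f"
          using MRF by blast
        then have "r \<in> R" "n + f \<in> complex_vector.span (N \<union> C)" "x = r + (n + f)"
          unfolding N'eq using mn by auto
        then show ?thesis
          by blast
      qed
    qed
    show "T ` R = R"
      by fact
    show "complex_vector.span (N \<union> C) \<subseteq> quasinilpotent_part T"
      unfolding N'eq using Fq qn complex_vector.subspace_add[OF csubspace_quasinilpotent_part[OF T]]
      by blast
  qed
qed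

subsection \<open>Commuting projections\<close>

lemma projection_Red:
  assumes T: "bounded_clinear T" and P: "bounded_projection P" and comm: "P \<circ> T = T \<circ> P"
  shows "({x. P x = 0}, {x. P x = x}) \<in> Red T"
  unfolding Red_iff
proof (intro conjI allI)
  have bP: "bounded_clinear P" and PP: "P (P x) = P x" for x
    using P by (auto simp: bounded_projection_def fun_eq_iff)
  note lin = bounded_clinearD[OF bP]
  have cont: "continuous_on UNIV P"
    by (rule linear_continuous_on[OF lin(1)])
  have PT: "P (T x) = T (P x)" for x
    using comm by (simp add: fun_eq_iff)
  show "closed_csubspace {x. P x = 0}" "closed_csubspace {x. P x = x}"
    unfolding closed_csubspace_def complex_vector.subspace_def
    using closed_Collect_eq[OF cont continuous_on_const[of _ 0]] closed_Collect_eq[OF cont continuous_on_id]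
    by (simp_all add: lin)
  show "T ` {x. P x = 0} \<subseteq> {x. P x = 0}" "T ` {x. P x = x} \<subseteq> {x. P x = x}"
    by (auto simp: PT bounded_clinearD[OF T])
  show "{x. P x = 0} \<inter> {x. P x = x} \<subseteq> {0}"
    by auto
  show "\<exists>m\<in>{x. P x = 0}. \<exists>n\<in>{x. P x = x}. x = m + n" for x
    by (intro bexI[of _ "x - P x"] bexI[of _ "P x"]) (simp_all add: lin PP)
qed

lemma quasinilpotent_part_comp_projection:
  assumes T: "bounded_clinear T" and P: "bounded_projection P" and comm: "P \<circ> T = T \<circ> P"
  shows "UNIV \<subseteq> quasinilpotent_part (T \<circ> P) \<longleftrightarrow> {x. P x = x} \<subseteq> quasinilpotent_part T"
proof -
  have bP: "bounded_clinear P" and PP: "P (P x) = P x" for x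
    using P by (auto simp: bounded_projection_def fun_eq_iff)
  have bTP: "bounded_clinear (T \<circ> P)"
    using bounded_clinear_compose[OF T bP] by (simp add: comp_def)
  have PT: "P (T x) = T (P x)" for x
    using comm by (simp add: fun_eq_iff)
  have PTn: "P ((T ^^ n) x) = (T ^^ n) (P x)" for n x
    by (induction n) (simp_all add: PT)
  have pow: "((T \<circ> P) ^^ n) x = (T ^^ n) x" if "P x = x" for n x
    by (induction n) (simp_all add: PTn that)
  then have iff: "x \<in> quasinilpotent_part (T \<circ> P) \<longleftrightarrow> x \<in> quasinilpotent_part T" if "P x = x" for x
    using that by (simp add: quasinilpotent_part_def)
  have "x \<in> quasinilpotent_part (T \<circ> P)" if "{x. P x = x} \<subseteq> quasinilpotent_part T" for x
  proof -
    have "P x \<in> quasinilpotent_part (T \<circ> P)"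
      using that PP iff by blast
    moreover have "x - P x \<in> quasinilpotent_part (T \<circ> P)"
      by (rule nilpotent_imp_quasinilpotent_part[OF bTP, where p = 1])
        (simp add: bounded_clinearD[OF bP] bounded_clinearD[OF T] PP)
    ultimately have "P x + (x - P x) \<in> quasinilpotent_part (T \<circ> P)"
      by (rule complex_vector.subspace_add[OF csubspace_quasinilpotent_part[OF bTP]])
    then show ?thesis
      by simp
  qed
  then show ?thesis
    using iff by blast
qed

lemma surj_add_projection:
  fixes T :: "'a :: complex_banach \<Rightarrow> 'a"
  assumes T: "bounded_clinear T" and MN: "(M, N) \<in> Red T" and surj: "T ` M = M"
    and qn: "N \<subseteq> quasinilpotent_part T"
  obtains P where "bounded_projection P" "P \<circ> T = T \<circ> P" "surj (\<lambda>x. T x + P x)"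
    "UNIV \<subseteq> quasinilpotent_part (T \<circ> P)"
proof -
  note R = RedD[OF MN]
  obtain P where P: "bounded_projection P" "P \<circ> T = T \<circ> P" "\<And>x. P x \<in> N" "\<And>x. x - P x \<in> M"
    "\<And>x. x \<in> M \<Longrightarrow> P x = 0" "\<And>x. x \<in> N \<Longrightarrow> P x = x"
    using Red_projection[OF T MN] by metis
  let ?S = "\<lambda>x. T x + P x"
  have bS: "bounded_clinear ?S"
    using T P(1) by (auto simp: bounded_projection_def intro: bounded_clinear_add)
  have SM: "?S ` M = M"
    using surj P(5) by simp
  have "?S ` N = (\<lambda>x. T x - (- 1) *\<^sub>C x) ` N"
    using P(6) by (intro image_cong) (simp_all add: complex_vector.scale_minus_left scaleC_one)
  also have "\<dots> = N"
    using R(2,4) qn by (intro quasinilpotent_shift_surjective[OF T]) auto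
  finally have SN: "?S ` N = N" .
  have "(M, N) \<in> Red ?S"
    using MN SM SN by (simp add: Red_iff)
  then have "surj ?S"
    using Red_surj_iff[OF bS] SM SN by blast
  have "x \<in> N" if "P x = x" for x
    using P(3)[of x] that by simp
  then have "UNIV \<subseteq> quasinilpotent_part (T \<circ> P)"
    unfolding quasinilpotent_part_comp_projection[OF T P(1,2)] using qn by blast
  with P(1,2) \<open>surj ?S\<close> show thesis
    by (rule that)
qed

lemma lower_semi_Browder_on_kernel:
  assumes T: "bounded_clinear T" and P: "bounded_projection P" and comm: "P \<circ> T = T \<circ> P"
    and Br: "lower_semi_Browder_on UNIV (\<lambda>x. T x + P x)"
  shows "lower_semi_Browder_on {x. P x = 0} T"
proof -
  let ?S = "\<lambda>x. T x + P x" and ?Q = "\<lambda>x. x - P x" and ?M = "{x. P x = 0}"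
  have bP: "bounded_clinear P" and PP: "P (P x) = P x" for x
    using P by (auto simp: bounded_projection_def fun_eq_iff)
  note lin = bounded_clinearD[OF bP] and linT = bounded_clinearD[OF T]
  have bQ: "bounded_clinear ?Q"
    using bounded_clinear_shift[OF bP, of 1] bounded_clinear_compose[OF bounded_clinear_scaleC[of "- 1"]]
    by (fastforce simp: complex_vector.scale_minus_left scaleC_one)
  have PT: "P (T x) = T (P x)" for x
    using comm by (simp add: fun_eq_iff)
  have Mrange: "?M = range ?Q"
    by (auto simp: lin PP image_iff intro: exI[of _ "_ :: 'a"]) (metis diff_zero)
  have Red: "(?M, {x. P x = x}) \<in> Red T"
    by (rule projection_Red[OF T P comm])
  note M = closed_csubspaceD[OF RedD(1)[OF Red]]
  have QS: "?Q (?S x) = T (?Q x)" for x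
    by (simp add: lin linT PT PP)
  have QSn: "?Q ((?S ^^ n) x) = (T ^^ n) (?Q x)" for n x
  proof (induction n)
    case (Suc n)
    then show ?case
      using QS[of "(?S ^^ n) x"] by simp
  qed simp
  have QSn_image: "?Q ` (?S ^^ n) ` UNIV = (T ^^ n) ` ?M" for n
    unfolding Mrange by (simp add: image_image QSn)
  obtain B n where B: "finite B" "complex_vector.span (range ?S \<union> B) = UNIV"
    and n: "(?S ^^ n) ` UNIV = (?S ^^ (n + 1)) ` UNIV"
    using Br unfolding lower_semi_Browder_on_iff by blast
  have "complex_vector.span (T ` ?M \<union> ?Q ` B) = ?M"
  proof
    have "T ` ?M \<union> ?Q ` B \<subseteq> ?M"
      by (auto simp: lin linT PT PP)
    then show "complex_vector.span (T ` ?M \<union> ?Q ` B) \<subseteq> ?M"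
      using M(2) by (rule complex_vector.span_minimal)
    have "?Q ` complex_vector.span (range ?S \<union> B) \<subseteq> complex_vector.span (T ` ?M \<union> ?Q ` B)"
    proof (rule span_image_subset[OF bQ])
      have eq: "?Q ` (range ?S \<union> B) = T ` ?M \<union> ?Q ` B"
        using QSn_image[of 1] by (simp add: image_Un)
      show "?Q ` (range ?S \<union> B) \<subseteq> complex_vector.span (T ` ?M \<union> ?Q ` B)"
        unfolding eq by (rule complex_vector.span_superset)
    qed (rule complex_vector.subspace_span)
    then show "?M \<subseteq> complex_vector.span (T ` ?M \<union> ?Q ` B)"
      unfolding B(2) Mrange .
  qed
  moreover have "?Q ` B \<subseteq> ?M"
    by (auto simp: lin PP)
  moreover have "(T ^^ n) ` ?M = (T ^^ (n + 1)) ` ?M"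
    by (simp only: n flip: QSn_image)
  ultimately show ?thesis
    unfolding lower_semi_Browder_on_iff using B(1) by blast
qed

lemma lower_semi_Browder_shift_surj:
  fixes T :: "'a :: complex_banach \<Rightarrow> 'a"
  assumes T: "bounded_clinear T" and Br: "lower_semi_Browder_on UNIV T"
  obtains e where "e > 0" "\<And>c. c \<noteq> 0 \<Longrightarrow> cmod c < e \<Longrightarrow> surj (\<lambda>x. T x - c *\<^sub>C x)"
proof -
  have "(UNIV, {0}) \<in> Red T"
    by (simp add: Red_iff closed_csubspace_def bounded_clinearD[OF T])
  moreover have "{0} \<subseteq> quasinilpotent_part T"
    using complex_vector.subspace_0[OF csubspace_quasinilpotent_part[OF T]] by simp
  ultimately obtain M N where "(M, N) \<in> Red T" "T ` M = M" "N \<subseteq> quasinilpotent_part T"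
    using lower_semi_Browder_decomposition[OF T _ Br] by metis
  then show thesis
    using Red_shift_surj[OF T] that by metis
qed

theorem theorem3p5:
  fixes T :: "'a :: complex_banach \<Rightarrow> 'a"
  assumes "infinite_dimensional TYPE('a)"
    and "bounded_clinear T"
  shows "let
      c1 = closed (analytical_core T) \<and>
        (\<exists>N. closed_csubspace N \<and> N \<subseteq> quasinilpotent_part T \<and> (analytical_core T, N) \<in> Red T);
      c2 = (\<exists>(M, N) \<in> Red T. T ` M = M \<and> quasinilpotent_on N T);
      c3 = generalized_Kato_decomposition T \<and> \<not> 0 islimpt surjective_spectrum T;
      c4 = generalized_Kato_decomposition T \<and> 0 \<notin> interior (surjective_spectrum T);
      c5 = (\<exists>P. bounded_projection P \<and> P \<circ> T = T \<circ> P \<and>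
        surj (\<lambda>x. T x + P x) \<and> quasinilpotent_on UNIV (T \<circ> P));
      c6 = (\<exists>(M, N) \<in> Red T. lower_semi_Browder_on M T \<and> quasinilpotent_on N T);
      c7 = generalized_Kato_decomposition T \<and> \<not> 0 islimpt lower_semi_Browder_spectrum T;
      c8 = generalized_Kato_decomposition T \<and> 0 \<notin> interior (lower_semi_Browder_spectrum T);
      c9 = (\<exists>P. bounded_projection P \<and> P \<circ> T = T \<circ> P \<and>
        lower_semi_Browder_on UNIV (\<lambda>x. T x + P x) \<and> quasinilpotent_on UNIV (T \<circ> P))
    in (c1 \<longleftrightarrow> c2) \<and> (c2 \<longleftrightarrow> c3) \<and> (c3 \<longleftrightarrow> c4) \<and> (c4 \<longleftrightarrow> c5) \<and>
       (c5 \<longleftrightarrow> c6) \<and> (c6 \<longleftrightarrow> c7) \<and> (c7 \<longleftrightarrow> c8) \<and> (c8 \<longleftrightarrow> c9) \<and>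
       (c1 \<or> c2 \<or> c3 \<or> c4 \<or> c5 \<or> c6 \<or> c7 \<or> c8 \<or> c9 \<longrightarrow>
         (\<exists>!M. \<exists>N. (M, N) \<in> Red T \<and> T ` M = M \<and> quasinilpotent_on N T) \<and>
         (\<forall>M N. (M, N) \<in> Red T \<and> T ` M = M \<and> quasinilpotent_on N T \<longrightarrow> M = analytical_core T))"
proof -
  note T = assms(2)
  define s where "s \<longleftrightarrow> (\<exists>M N. (M, N) \<in> Red T \<and> T ` M = M \<and> quasinilpotent_on N T)"
  have qiff: "quasinilpotent_on N T \<longleftrightarrow> N \<subseteq> quasinilpotent_part T" if "closed_csubspace N" for N
    using quasinilpotent_on_iff_subset[OF bounded_clinearD(1)[OF T]] closed_csubspaceD[OF that] by blast
  have qiffR: "quasinilpotent_on N T \<longleftrightarrow> N \<subseteq> quasinilpotent_part T" if "(M, N) \<in> Red T" for M N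
    by (rule qiff[OF RedD(2)[OF that]])
  have qP: "quasinilpotent_on UNIV (T \<circ> P) \<longleftrightarrow> UNIV \<subseteq> quasinilpotent_part (T \<circ> P)"
    if "bounded_projection P" for P
  proof (rule quasinilpotent_on_iff_subset)
    show "bounded_linear (T \<circ> P)"
      using bounded_clinearD(1)[OF bounded_clinear_compose[OF T, of P]] that
      by (simp add: comp_def bounded_projection_def)
  qed auto
  have core: "M = analytical_core T" if "(M, N) \<in> Red T" "T ` M = M" "quasinilpotent_on N T" for M N
    using analytical_core_eq[OF T] that by simp

  let ?K = "analytical_core T"
  let ?c1 = "closed ?K \<and>
        (\<exists>N. closed_csubspace N \<and> N \<subseteq> quasinilpotent_part T \<and> (?K, N) \<in> Red T)"
  let ?c2 = "\<exists>(M, N) \<in> Red T. T ` M = M \<and> quasinilpotent_on N T"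
  let ?c3 = "generalized_Kato_decomposition T \<and> \<not> 0 islimpt surjective_spectrum T"
  let ?c4 = "generalized_Kato_decomposition T \<and> 0 \<notin> interior (surjective_spectrum T)"
  let ?c5 = "\<exists>P. bounded_projection P \<and> P \<circ> T = T \<circ> P \<and>
        surj (\<lambda>x. T x + P x) \<and> quasinilpotent_on UNIV (T \<circ> P)"
  let ?c6 = "\<exists>(M, N) \<in> Red T. lower_semi_Browder_on M T \<and> quasinilpotent_on N T"
  let ?c7 = "generalized_Kato_decomposition T \<and> \<not> 0 islimpt lower_semi_Browder_spectrum T"
  let ?c8 = "generalized_Kato_decomposition T \<and> 0 \<notin> interior (lower_semi_Browder_spectrum T)"
  let ?c9 = "\<exists>P. bounded_projection P \<and> P \<circ> T = T \<circ> P \<and>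
        lower_semi_Browder_on UNIV (\<lambda>x. T x + P x) \<and> quasinilpotent_on UNIV (T \<circ> P)"

  have c2: "?c2 \<longleftrightarrow> s"
    unfolding s_def by auto
  have c1: "?c1 \<longleftrightarrow> s"
  proof
    assume ?c1
    then obtain N where N: "closed_csubspace N" "N \<subseteq> quasinilpotent_part T" "(?K, N) \<in> Red T"
      by blast
    then have "T ` ?K = ?K"
      using RedD(3) analytical_core_subset_image[OF bounded_clinearD(1)[OF T]] by blast
    with N qiff show s
      unfolding s_def by blast
  next
    assume s
    then obtain M N where MN: "(M, N) \<in> Red T" "T ` M = M" "quasinilpotent_on N T"
      unfolding s_def by blast
    then show ?c1
      using core[OF MN] qiffR RedD(1,2)[OF MN(1)] closed_csubspaceD(1) by blast
  qed
  have s3: ?c3 if s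
  proof
    obtain M N where MN: "(M, N) \<in> Red T" "T ` M = M" "quasinilpotent_on N T"
      using \<open>s\<close> unfolding s_def by blast
    have "Kato_on M T"
      using funpow_image_eq[OF MN(2)] closed_csubspaceD(1)[OF RedD(1)[OF MN(1)]] MN(2)
      by (auto simp: Kato_on_def)
    then show "generalized_Kato_decomposition T"
      using MN(1,3) by (auto simp: generalized_Kato_decomposition_def)
    obtain e where "e > 0" "\<And>c. c \<noteq> 0 \<Longrightarrow> cmod c < e \<Longrightarrow> surj (\<lambda>x. T x - c *\<^sub>C x)"
      using Red_shift_surj[OF T MN(1,2)] MN qiffR by metis
    then show "\<not> 0 islimpt surjective_spectrum T"
      by (auto simp: islimpt_approachable surjective_spectrum_def)
  qed
  have interior: "0 \<notin> interior S" if "\<not> 0 islimpt S" for S :: "complex set"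
    using that interior_limit_point by blast
  have sub: "lower_semi_Browder_spectrum T \<subseteq> surjective_spectrum T"
    by (auto simp: lower_semi_Browder_spectrum_def surjective_spectrum_def
        intro: lower_semi_Browder_on_surj)
  have c8_c4: ?c4 if ?c8
  proof
    show "generalized_Kato_decomposition T"
      using \<open>?c8\<close> by blast
    show "0 \<notin> interior (surjective_spectrum T)"
    proof
      assume "0 \<in> interior (surjective_spectrum T)"
      then obtain e where e: "e > 0" "ball 0 e \<subseteq> surjective_spectrum T"
        by (auto simp: mem_interior)
      obtain l where l: "l \<in> ball 0 e" "l \<notin> lower_semi_Browder_spectrum T"
        using \<open>?c8\<close> e(1) unfolding mem_interior by blast
      have "lower_semi_Browder_on UNIV (\<lambda>x. T x - l *\<^sub>C x)"
        using l(2) by (simp add: lower_semi_Browder_spectrum_def)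
      from lower_semi_Browder_shift_surj[OF bounded_clinear_shift[OF T] this]
      obtain d where d: "d > 0"
        "\<And>c. c \<noteq> 0 \<Longrightarrow> cmod c < d \<Longrightarrow> surj (\<lambda>x. T x - l *\<^sub>C x - c *\<^sub>C x)"
        by blast
      define t where "t = min d (e - cmod l) / 2"
      have t: "0 < t" "t < d" "t < e - cmod l"
        using d(1) l(1) by (auto simp: t_def)
      have "surj (\<lambda>x. T x - l *\<^sub>C x - complex_of_real t *\<^sub>C x)"
        using t by (intro d(2)) auto
      then have "l + complex_of_real t \<notin> surjective_spectrum T"
        by (simp add: surjective_spectrum_def scaleC_add_left diff_diff_eq)
      moreover have "l + complex_of_real t \<in> ball 0 e"
        using t norm_triangle_ineq[of l "complex_of_real t"] by simp
      ultimately show False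
        using e(2) by blast
    qed
  qed
  have c4_s: s if ?c4
  proof -
    obtain M N where MN: "(M, N) \<in> Red T" "Kato_on M T" "quasinilpotent_on N T"
      using \<open>?c4\<close> by (auto simp: generalized_Kato_decomposition_def)
    have "T ` M = M"
    proof (rule Kato_surjective[OF T RedD(1,3)[OF MN(1)] MN(2)])
      fix e :: real assume "e > 0"
      then obtain c where "c \<in> ball 0 e" "c \<notin> surjective_spectrum T"
        using \<open>?c4\<close> unfolding mem_interior by blast
      then show "\<exists>c. cmod c < e \<and> (\<lambda>x. T x - c *\<^sub>C x) ` M = M"
        using Red_surj_iff[OF bounded_clinear_shift[OF T] Red_shift[OF MN(1)]]
        by (auto simp: surjective_spectrum_def)
    qed
    with MN show s
      unfolding s_def by blast
  qed
  have c3: "?c3 \<longleftrightarrow> s" and c4: "?c4 \<longleftrightarrow> s"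
    using s3 interior c4_s by blast+
  have c7: "?c7 \<longleftrightarrow> s" and c8: "?c8 \<longleftrightarrow> s"
    using s3 interior c4_s c8_c4 islimpt_subset[OF _ sub] by blast+
  have s5: ?c5 if s
  proof -
    obtain M N where MN: "(M, N) \<in> Red T" "T ` M = M" "quasinilpotent_on N T"
      using \<open>s\<close> unfolding s_def by blast
    have qn: "N \<subseteq> quasinilpotent_part T"
      using MN qiffR by blast
    obtain P where "bounded_projection P" "P \<circ> T = T \<circ> P" "surj (\<lambda>x. T x + P x)"
      "UNIV \<subseteq> quasinilpotent_part (T \<circ> P)"
      using surj_add_projection[OF T MN(1,2) qn] by metis
    with qP show ?c5
      by blast
  qed
  have c5_c9: ?c9 if ?c5
    using that lower_semi_Browder_on_surj[OF complex_vector.subspace_UNIV] by blast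
  have c9_c6: ?c6 if ?c9
  proof -
    obtain P where P: "bounded_projection P" "P \<circ> T = T \<circ> P"
      "lower_semi_Browder_on UNIV (\<lambda>x. T x + P x)" "quasinilpotent_on UNIV (T \<circ> P)"
      using \<open>?c9\<close> by blast
    have Red: "({x. P x = 0}, {x. P x = x}) \<in> Red T"
      by (rule projection_Red[OF T P(1,2)])
    have "quasinilpotent_on {x. P x = x} T"
      using quasinilpotent_part_comp_projection[OF T P(1,2)] qP[OF P(1)] P(4) qiffR[OF Red] by blast
    with Red lower_semi_Browder_on_kernel[OF T P(1-3)] show ?c6
      by blast
  qed
  have c6_s: s if ?c6
  proof -
    obtain M N where MN: "(M, N) \<in> Red T" "lower_semi_Browder_on M T" "quasinilpotent_on N T"
      using \<open>?c6\<close> by blast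
    have "N \<subseteq> quasinilpotent_part T"
      using MN qiffR by blast
    from lower_semi_Browder_decomposition[OF T MN(1,2) this]
    obtain R N' where "(R, N') \<in> Red T" "T ` R = R" "N' \<subseteq> quasinilpotent_part T"
      by blast
    with qiffR show s
      unfolding s_def by blast
  qed
  have c5: "?c5 \<longleftrightarrow> s" and c9: "?c9 \<longleftrightarrow> s" and c6: "?c6 \<longleftrightarrow> s"
    using s5 c5_c9 c9_c6 c6_s by blast+
  have uniq: "s \<longrightarrow> (\<exists>!M. \<exists>N. (M, N) \<in> Red T \<and> T ` M = M \<and> quasinilpotent_on N T) \<and>
      (\<forall>M N. (M, N) \<in> Red T \<and> T ` M = M \<and> quasinilpotent_on N T \<longrightarrow> M = ?K)"
  proof (intro impI conjI allI)
    assume s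
    then obtain M N where MN: "(M, N) \<in> Red T \<and> T ` M = M \<and> quasinilpotent_on N T"
      unfolding s_def by blast
    show "\<exists>!M. \<exists>N. (M, N) \<in> Red T \<and> T ` M = M \<and> quasinilpotent_on N T"
    proof (rule ex1I[of _ M])
      show "\<exists>N. (M, N) \<in> Red T \<and> T ` M = M \<and> quasinilpotent_on N T"
        using MN by (rule exI)
      show "M' = M" if "\<exists>N. (M', N) \<in> Red T \<and> T ` M' = M' \<and> quasinilpotent_on N T" for M'
        using that MN core by metis
    qed
  qed (elim conjE, rule core)
  show ?thesis
    unfolding Let_def c1 c2 c3 c4 c5 c6 c7 c8 c9 using uniq by simp
qed

end
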